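(* Let $p\ge 1$ and let $l_1,l_2$ be smooth functions of $(\omega^k,\omega^{k+1},\epsilon)$ such that the one-step scheme $$\frac{\omega_1^{k+1}-\omega_1^{k}}{\epsilon}=\frac{1}{|\mathbb I_m|}\bigl(\mathbb I_{22}l_1-\mathbb I_{12}l_2\bigr),\qquad \frac{\omega_2^{k+1}-\omega_2^{k}}{\epsilon}=\frac{1}{|\mathbb I_m|}\bigl(-\mathbb I_{21}l_1+\mathbb I_{11}l_2\bigr)$$ (with $l_j=l_j(\omega^k,\omega^{k+1},\epsilon)$) is a $p$-th order consistent discretization of $$\dot\omega_1=-\frac{1}{|\mathbb I_m|}(\mathbb I_{22}\omega_2+\mathbb I_{12}\omega_1)(\mathbb I_{31}\omega_1+\mathbb I_{32}\omega_2),\qquad \dot\omega_2=\frac{1}{|\mathbb I_m|}(\mathbb I_{21}\omega_2+\mathbb I_{11}\omega_1)(\mathbb I_{31}\omega_1+\mathbb I_{32}\omega_2),$$ i.e. $|\omega(t_k+\epsilon)-\omega^{k+1}|=O(\epsilon^{p+1})$. Then this scheme together with $\omega_3^{k+1}=0$ and $\lambda_{k+1}=\lambda(\omega^{k+1})$, where $$\lambda(\omega)=\omega_1(\mathbb I_{2i}\omega_i)-\omega_2(\mathbb I_{1i}\omega_i)+\frac{\mathbb I_{3i}\omega_i}{|\mathbb I_m|}\bigl((\mathbb I_{32}\mathbb I_{21}-\mathbb I_{31}\mathbb I_{22})\omega_2+(\mathbb I_{32}\mathbb I_{11}-\mathbb I_{31}\mathbb I_{12})\omega_1\bigr)$$ (sum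 over $i=1,2$), is a discretization of the Suslov problem of order $(p,p)$; and consequently, with the reconstruction $R_{k+1}=R_k\,\mathrm{cay}(\epsilon\hat\omega^k)$, $v_{R_k}=R_k\hat\omega^k$, it is a discretization at least of order $(1,p)$ of the unreduced nonholonomic equations on $SO(3)$.
   Context: Notation: $\hat\cdot:\mathbb R^3\to\mathfrak{so}(3)$ is the standard isomorphism with $\hat\omega x=\omega\times x$; the distance on $\mathfrak{so}(3)$ is the Euclidean distance of $\mathbb R^3$; on $SO(3)$, $\mathrm{dist}(R_1,R_2)=|I-R_1R_2^T|$ with $|A|^2=\sum_{ij}|A_{ij}|^2$; $\mathrm{cay}(\hat\omega)=(I-\frac{\hat\omega}2)^{-1}(I+\frac{\hat\omega}2)$. $\mathbb I=(\mathbb I_{ij})$ is a symmetric positive definite $3\times3$ inertia tensor, $\mathbb I_m$ its upper-left $2\times2$ block and $|\mathbb I_m|$ the determinant of $\mathbb I_m$. An upper index $k$ denotes the time step. Suslov problem: $\mathbb I\dot\omega=\mathbb I\omega\times\omega+\lambda e_3$, $\omega_3=0$, $e_3=(0,0,1)$, with solutions $(\omega(t),\lambda^{\rm red}(t))$. It decouples into the ODE for $(\omega_1,\omega_2)$ in the claim and the formula $\lambda^{\rm red}(t)=\lambda(\omega(t))$. The unreduced system on $SO(3)$ is the Lagrange-d'Alembert system with Lagrangian $L(R,\dot R)=\frac12\langle\mathbb I\omega,\omega\rangle$, $\hat\omega=R^{-1}\dot R$, and constraint distribution $D_R=\{R\hat\omega:\omega_3=0\}$, with multiplier $\lambda^{\rm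 unr}$ taken with respect to the annihilating one-form $\mu(R)=\ell^*_{R^{-1}}e_3$ ($\ell$ = left translation); its solutions satisfy $\dot R=R\hat\omega$ with $\omega$ a solution of the Suslov problem. Order $(p,s)$ for the Suslov problem: $|\omega(t_k+\epsilon)-\omega^{k+1}|=O(\epsilon^{p+1})$ and $|\lambda^{\rm red}(t_k+\epsilon)-\lambda_{k+1}|=O(\epsilon^{s+1})$. Order $(p,s)$ for the unreduced equations: $\mathrm{dist}(R(t_k+\epsilon),R_{k+1})=O(\epsilon^{r+1})$, $|R(t_k+\epsilon)^{-1}v_{R(t_k+\epsilon)}-R_{k+1}^{-1}v_{R_{k+1}}|=O(\epsilon^{q+1})$ with $\min(r,q)=p$, and $|\lambda^{\rm unr}(t_k+\epsilon)-\lambda_{k+1}|=O(\epsilon^{s+1})$. All errors are local (one-step) errors as the step size $\epsilon\to0$, with exact solution satisfying $\omega(t_k)=\omega^k$ (with $\omega^k_3=0$) and $R(t_k)=R_k$. *)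

theory Defs
  imports "HOL-Analysis.Analysis"
begin

section \<open>Differentiability classes\<close>

text \<open>Intended for open \<open>S\<close> (all the uses below are of this kind). In finite dimension, \<open>f\<close> is
  \<open>C\<^sup>k\<^sup>+\<^sup>1\<close> iff it is differentiable with all directional derivatives \<open>C\<^sup>k\<close>.\<close>

primrec Ck_on :: "nat \<Rightarrow> ('a::euclidean_space \<Rightarrow> 'b::real_normed_vector) \<Rightarrow> 'a set \<Rightarrow> bool" where
  "Ck_on 0 f S \<longleftrightarrow> continuous_on S f"
| "Ck_on (Suc k) f S \<longleftrightarrow>
     f differentiable_on S \<and> (\<forall>v. Ck_on k (\<lambda>x. frechet_derivative f (at x) v) S)"

definition smooth_on :: "'a::euclidean_space set \<Rightarrow> ('a \<Rightarrow> 'b::real_normed_vector) \<Rightarrow> bool" where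
  "smooth_on S f \<longleftrightarrow> (\<forall>k. Ck_on k f S)"


section \<open>The rotation group and its Lie algebra\<close>

text \<open>On \<open>real^3^3\<close> the library norm is the Frobenius norm. The distance of two elements of so(3) is
  the Euclidean norm of the difference of their images under \<open>vee\<close>, the inverse of \<open>hat\<close>.\<close>

definition hat :: "real^3 \<Rightarrow> real^3^3" where
  "hat w = matrix (cross3 w)"

definition vee :: "real^3^3 \<Rightarrow> real^3" where
  "vee A = vector [A$3$2, A$1$3, A$2$1]"

lemma hat_mult: "hat w *v x = cross3 w x"
  by (simp add: hat_def matrix_def matrix_vector_mult_def cross3_simps axis_def forall_3)

lemma vee_hat [simp]: "vee (hat w) = w"
  by (simp add: vee_def hat_def matrix_def cross3_simps axis_def forall_3)

lemma hat_vee: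
  assumes "transpose A = - A"
  shows "hat (vee A) = A"
proof -
  have *: "A$j$i = - A$i$j" for i j
    using arg_cong[OF assms, of "\<lambda>B. B$i$j"] by (simp add: transpose_def)
  show ?thesis
    using *[of 1 1] *[of 2 2] *[of 3 3] *[of 1 2] *[of 1 3] *[of 2 3]
    by (simp add: vee_def hat_def matrix_def cross3_simps axis_def forall_3)
qed

definition rot_dist :: "real^3^3 \<Rightarrow> real^3^3 \<Rightarrow> real" where
  "rot_dist R1 R2 = norm (mat 1 - R1 ** transpose R2)"

lemma rot_dist_frobenius:
  "(rot_dist R1 R2)\<^sup>2 = (\<Sum>i\<in>UNIV. \<Sum>j\<in>UNIV. ((mat 1 - R1 ** transpose R2)$i$j)\<^sup>2)"
  by (simp add: rot_dist_def norm_vec_def L2_set_def sum_nonneg)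

definition cay :: "real^3^3 \<Rightarrow> real^3^3" where
  "cay A = matrix_inv (mat 1 - (1/2) *\<^sub>R A) ** (mat 1 + (1/2) *\<^sub>R A)"


section \<open>Inertia tensor and Suslov problem\<close>

definition inertia_tensor :: "real^3^3 \<Rightarrow> bool" where
  "inertia_tensor J \<longleftrightarrow> transpose J = J \<and> (\<forall>x. x \<noteq> 0 \<longrightarrow> 0 < x \<bullet> (J *v x))"

definition upper_left_block :: "real^3^3 \<Rightarrow> real^2^2" where
  "upper_left_block J = vector [vector [J$1$1, J$1$2], vector [J$2$1, J$2$2]]"

definition suslov_solution ::
  "real^3^3 \<Rightarrow> real set \<Rightarrow> (real \<Rightarrow> real^3) \<Rightarrow> (real \<Rightarrow> real) \<Rightarrow> bool" where
  "suslov_solution J T w lam \<longleftrightarrow>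
     (\<forall>t\<in>T. w t $ 3 = 0 \<and>
       (\<exists>w'. (w has_vector_derivative w') (at t) \<and>
             J *v w' = cross3 (J *v w t) (w t) + lam t *\<^sub>R axis 3 1))"

text \<open>The decoupled equation for \<open>(\<omega>\<^sub>1, \<omega>\<^sub>2)\<close>, obtained by solving the first two components of the
  Suslov equation, and the multiplier, obtained from the third one.\<close>

definition suslov_field :: "real^3^3 \<Rightarrow> real^2 \<Rightarrow> real^2" where
  "suslov_field J u =
     vector
       [- (1 / det (upper_left_block J)) *
            (J$2$2 * u$2 + J$1$2 * u$1) * (J$3$1 * u$1 + J$3$2 * u$2),
        (1 / det (upper_left_block J)) *
            (J$2$1 * u$2 + J$1$1 * u$1) * (J$3$1 * u$1 + J$3$2 * u$2)]"

definition suslov_multiplier :: "real^3^3 \<Rightarrow> real^3 \<Rightarrow> real" where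
  "suslov_multiplier J w =
     w$1 * (\<Sum>i\<in>{1,2}. J$2$i * w$i) - w$2 * (\<Sum>i\<in>{1,2}. J$1$i * w$i)
     + (\<Sum>i\<in>{1,2}. J$3$i * w$i) / det (upper_left_block J)
       * ((J$3$2 * J$2$1 - J$3$1 * J$2$2) * w$2 + (J$3$2 * J$1$1 - J$3$1 * J$1$2) * w$1)"


section \<open>Lagrange-d'Alembert equations on the rotation group\<close>

text \<open>A variation of the curve \<open>R\<close> (defined on the open interval \<open>T\<close>) with endpoints fixed
  at \<open>a\<close> and \<open>b\<close>; the first argument of \<open>Q\<close> is the variation parameter.\<close>

definition fixed_endpoint_variation ::
  "(real \<times> real \<Rightarrow> real^3^3) \<Rightarrow> (real \<Rightarrow> real^3^3) \<Rightarrow> real set \<Rightarrow> real \<Rightarrow> real \<Rightarrow> bool" where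
  "fixed_endpoint_variation Q R T a b \<longleftrightarrow>
     (\<exists>\<delta>>0. Ck_on 2 Q ({-\<delta><..<\<delta>} \<times> T) \<and>
        (\<forall>s\<in>{-\<delta><..<\<delta>}. (\<forall>t\<in>T. rotation_matrix (Q (s, t))) \<and> Q (s, a) = R a \<and> Q (s, b) = R b) \<and>
        (\<forall>t\<in>T. Q (0, t) = R t))"

text \<open>Lagrangian \<open>L\<close>, constraint distribution \<open>D\<close>, annihilating one-form \<open>\<mu>\<close> and multiplier
  \<open>lam\<close>: for all variations \<open>\<delta>R\<close> with fixed endpoints,
  \<open>\<delta> \<integral> L(R, R') dt + \<integral> lam \<langle>\<mu>(R), \<delta>R\<rangle> dt = 0\<close>, that is,
  \<open>d/dt (\<partial>L/\<partial>R') - \<partial>L/\<partial>R = lam \<mu>(R)\<close>.\<close>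

definition lagrange_dalembert_solution ::
  "(real^3^3 \<Rightarrow> real^3^3 \<Rightarrow> real) \<Rightarrow> (real^3^3 \<Rightarrow> (real^3^3) set) \<Rightarrow> (real^3^3 \<Rightarrow> real^3^3 \<Rightarrow> real)
     \<Rightarrow> real set \<Rightarrow> (real \<Rightarrow> real^3^3) \<Rightarrow> (real \<Rightarrow> real) \<Rightarrow> bool" where
  "lagrange_dalembert_solution L D \<mu> T R lam \<longleftrightarrow>
     Ck_on 2 R T \<and> continuous_on T lam \<and>
     (\<forall>t\<in>T. rotation_matrix (R t) \<and> vector_derivative R (at t) \<in> D (R t)) \<and>
     (\<forall>a b Q. a < b \<and> {a..b} \<subseteq> T \<and> fixed_endpoint_variation Q R T a b \<longrightarrow>
        ((\<lambda>s. integral {a..b} (\<lambda>t. L (Q (s, t)) (vector_derivative (\<lambda>\<tau>. Q (s, \<tau>)) (at t))))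
           has_real_derivative
         - integral {a..b} (\<lambda>t. lam t * \<mu> (R t) (vector_derivative (\<lambda>s. Q (s, t)) (at 0)))) (at 0))"

definition suslov_lagrangian :: "real^3^3 \<Rightarrow> real^3^3 \<Rightarrow> real^3^3 \<Rightarrow> real" where
  "suslov_lagrangian J R V = (let w = vee (matrix_inv R ** V) in (1/2) * ((J *v w) \<bullet> w))"

definition suslov_distribution :: "real^3^3 \<Rightarrow> (real^3^3) set" where
  "suslov_distribution R = {R ** hat w | w. w$3 = 0}"

definition suslov_annihilator :: "real^3^3 \<Rightarrow> real^3^3 \<Rightarrow> real" where
  "suslov_annihilator R V = axis 3 1 \<bullet> vee (matrix_inv R ** V)"

definition unreduced_solution ::
  "real^3^3 \<Rightarrow> real set \<Rightarrow> (real \<Rightarrow> real^3^3) \<Rightarrow> (real \<Rightarrow> real) \<Rightarrow> bool" where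
  "unreduced_solution J T R lam \<longleftrightarrow>
     lagrange_dalembert_solution (suslov_lagrangian J) suslov_distribution suslov_annihilator T R lam"


section \<open>One-step schemes\<close>

text \<open>A scheme is given as a relation \<open>step \<epsilon> x\<^sub>k x\<^sub>k\<^sub>+\<^sub>1\<close>, since it may be implicit. Such an equation can
  have spurious solutions far from \<open>x\<^sub>k\<close>; the numerical solution, as a function of the step
  size, is the one that tends to \<open>x\<^sub>k\<close> as \<open>\<epsilon> \<rightarrow> 0\<close>. For smooth \<open>l\<^sub>1, l\<^sub>2\<close> it exists and is locally unique by the implicit
  function theorem; the definitions of order require existence so that they are never vacuous.\<close>

definition step_branch ::
  "(real \<Rightarrow> 'a::topological_space \<Rightarrow> 'a \<Rightarrow> bool) \<Rightarrow> 'a \<Rightarrow> (real \<Rightarrow> 'a) \<Rightarrow> bool" where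
  "step_branch step x y \<longleftrightarrow>
     (\<forall>\<^sub>F \<epsilon> in at_right 0. step \<epsilon> x (y \<epsilon>)) \<and> (y \<longlongrightarrow> x) (at_right 0)"

definition ode_order ::
  "(real^2 \<Rightarrow> real^2) \<Rightarrow> (real \<Rightarrow> real^2 \<Rightarrow> real^2 \<Rightarrow> bool) \<Rightarrow> nat \<Rightarrow> bool" where
  "ode_order F step p \<longleftrightarrow>
     (\<forall>a b tk u. tk \<in> {a<..<b} \<and> (\<forall>t\<in>{a<..<b}. (u has_vector_derivative F (u t)) (at t)) \<longrightarrow>
        (\<exists>u1. step_branch step (u tk) u1) \<and>
        (\<forall>u1. step_branch step (u tk) u1 \<longrightarrow>
           (\<lambda>\<epsilon>. norm (u (tk + \<epsilon>) - u1 \<epsilon>)) \<in> O[at_right 0](\<lambda>\<epsilon>. \<epsilon> ^ (p + 1))))"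

text \<open>Schemes with multiplier: \<open>step \<epsilon> x\<^sub>k x\<^sub>k\<^sub>+\<^sub>1 \<lambda>\<^sub>k\<^sub>+\<^sub>1\<close>.\<close>

definition suslov_order ::
  "real^3^3 \<Rightarrow> (real \<Rightarrow> real^3 \<Rightarrow> real^3 \<Rightarrow> real \<Rightarrow> bool) \<Rightarrow> nat \<Rightarrow> nat \<Rightarrow> bool" where
  "suslov_order J step p s \<longleftrightarrow>
     (\<forall>a b tk w lam. tk \<in> {a<..<b} \<and> suslov_solution J {a<..<b} w lam \<longrightarrow>
        (\<exists>w1 lam1. step_branch (\<lambda>\<epsilon> x y. step \<epsilon> x y (lam1 \<epsilon>)) (w tk) w1) \<and>
        (\<forall>w1 lam1. step_branch (\<lambda>\<epsilon> x y. step \<epsilon> x y (lam1 \<epsilon>)) (w tk) w1 \<longrightarrow>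
           (\<lambda>\<epsilon>. norm (w (tk + \<epsilon>) - w1 \<epsilon>)) \<in> O[at_right 0](\<lambda>\<epsilon>. \<epsilon> ^ (p + 1)) \<and>
           (\<lambda>\<epsilon>. \<bar>lam (tk + \<epsilon>) - lam1 \<epsilon>\<bar>) \<in> O[at_right 0](\<lambda>\<epsilon>. \<epsilon> ^ (s + 1))))"

text \<open>States of the unreduced system are pairs \<open>(R, v)\<close> of a rotation and a tangent vector at it.\<close>

definition unreduced_order ::
  "real^3^3 \<Rightarrow> (real \<Rightarrow> (real^3^3) \<times> (real^3^3) \<Rightarrow> (real^3^3) \<times> (real^3^3) \<Rightarrow> real \<Rightarrow> bool)
     \<Rightarrow> nat \<Rightarrow> nat \<Rightarrow> bool" where
  "unreduced_order J step p s \<longleftrightarrow>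
     (\<exists>r q. min r q = p \<and>
       (\<forall>a b tk R lam. tk \<in> {a<..<b} \<and> unreduced_solution J {a<..<b} R lam \<longrightarrow>
          (\<exists>X1 lam1. step_branch (\<lambda>\<epsilon> x y. step \<epsilon> x y (lam1 \<epsilon>))
                        (R tk, vector_derivative R (at tk)) X1) \<and>
          (\<forall>R1 v1 lam1. step_branch (\<lambda>\<epsilon> x y. step \<epsilon> x y (lam1 \<epsilon>))
                           (R tk, vector_derivative R (at tk)) (\<lambda>\<epsilon>. (R1 \<epsilon>, v1 \<epsilon>)) \<longrightarrow>
             (\<lambda>\<epsilon>. rot_dist (R (tk + \<epsilon>)) (R1 \<epsilon>)) \<in> O[at_right 0](\<lambda>\<epsilon>. \<epsilon> ^ (r + 1)) \<and>
             (\<lambda>\<epsilon>. norm (vee (matrix_inv (R (tk + \<epsilon>)) ** vector_derivative R (at (tk + \<epsilon>)))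
                        - vee (matrix_inv (R1 \<epsilon>) ** v1 \<epsilon>)))
               \<in> O[at_right 0](\<lambda>\<epsilon>. \<epsilon> ^ (q + 1)) \<and>
             (\<lambda>\<epsilon>. \<bar>lam (tk + \<epsilon>) - lam1 \<epsilon>\<bar>) \<in> O[at_right 0](\<lambda>\<epsilon>. \<epsilon> ^ (s + 1)))))"

definition planar_scheme ::
  "real^3^3 \<Rightarrow> ((real^2) \<times> (real^2) \<times> real \<Rightarrow> real) \<Rightarrow> ((real^2) \<times> (real^2) \<times> real \<Rightarrow> real)
     \<Rightarrow> real \<Rightarrow> real^2 \<Rightarrow> real^2 \<Rightarrow> bool" where
  "planar_scheme J l1 l2 \<epsilon> u u' \<longleftrightarrow>
     (u'$1 - u$1) / \<epsilon> = 1 / det (upper_left_block J) *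
        (J$2$2 * l1 (u, u', \<epsilon>) - J$1$2 * l2 (u, u', \<epsilon>)) \<and>
     (u'$2 - u$2) / \<epsilon> = 1 / det (upper_left_block J) *
        (- J$2$1 * l1 (u, u', \<epsilon>) + J$1$1 * l2 (u, u', \<epsilon>))"

definition suslov_scheme ::
  "real^3^3 \<Rightarrow> ((real^2) \<times> (real^2) \<times> real \<Rightarrow> real) \<Rightarrow> ((real^2) \<times> (real^2) \<times> real \<Rightarrow> real)
     \<Rightarrow> real \<Rightarrow> real^3 \<Rightarrow> real^3 \<Rightarrow> real \<Rightarrow> bool" where
  "suslov_scheme J l1 l2 \<epsilon> w w' lam' \<longleftrightarrow>
     planar_scheme J l1 l2 \<epsilon> (vector [w$1, w$2]) (vector [w'$1, w'$2]) \<and>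
     w$3 = 0 \<and> w'$3 = 0 \<and> lam' = suslov_multiplier J w'"

definition cayley_reconstruction ::
  "(real \<Rightarrow> real^3 \<Rightarrow> real^3 \<Rightarrow> real \<Rightarrow> bool)
     \<Rightarrow> real \<Rightarrow> (real^3^3) \<times> (real^3^3) \<Rightarrow> (real^3^3) \<times> (real^3^3) \<Rightarrow> real \<Rightarrow> bool" where
  "cayley_reconstruction step \<epsilon> = (\<lambda>(R, v) (R', v') lam'.
     \<exists>w w'. v = R ** hat w \<and> v' = R' ** hat w' \<and> step \<epsilon> w w' lam' \<and>
            R' = R ** cay (\<epsilon> *\<^sub>R hat w))"

end

theory Submission
  imports Defs
begin

text \<open>
  The multiplier is a quadratic form in the angular velocity, hence locally Lipschitz, so it inherits
  the order of the planar scheme; a solution of the Suslov problem satisfies the decoupled equations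
  because the upper-left block of the inertia tensor is invertible.

  For the unreduced system, the Lagrange-d'Alembert principle is tested with the variations
  \<open>R(t) exp(s \<phi>(t) e\<^sub>i)\<close> for \<open>\<phi>(t) = (t - a) (b - t)\<close>, along which the body angular velocity is an
  explicit trigonometric expression in \<open>s\<close>; integration by parts gives
  the components of the Suslov equation for \<open>\<omega> = R\<^sup>-\<^sup>1 R'\<close>. The Cayley step and the exact flow both agree
  with \<open>R (I + \<epsilon> \<omega>)\<close> (\<open>\<omega>\<close> read as a matrix) up to \<open>O(\<epsilon>\<^sup>2)\<close>, while the velocity and the multiplier
  keep the order of the reduced scheme.
\<close>

section \<open>Matrices, the hat map and the Cayley transform\<close>

lemma bounded_bilinear_matrix_matrix_mult:
  "bounded_bilinear ((**) :: real^'n^'m \<Rightarrow> real^'k^'n \<Rightarrow> real^'k^'m)"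
  unfolding bilinear_conv_bounded_bilinear[symmetric] bilinear_def linear_iff
  by (auto simp: matrix_matrix_mult_def vec_eq_iff algebra_simps sum.distrib sum_distrib_left)

interpretation matmul: bounded_bilinear "(**) :: real^'n^'m \<Rightarrow> real^'k^'n \<Rightarrow> real^'k^'m"
  by (rule bounded_bilinear_matrix_matrix_mult)

lemma bounded_bilinear_matrix_vector_mult:
  "bounded_bilinear ((*v) :: real^'n^'m \<Rightarrow> real^'n \<Rightarrow> real^'m)"
  unfolding bilinear_conv_bounded_bilinear[symmetric] bilinear_def linear_iff
  by (auto simp: matrix_vector_mult_def vec_eq_iff algebra_simps sum.distrib sum_distrib_left)

interpretation matvec: bounded_bilinear "(*v) :: real^'n^'m \<Rightarrow> real^'n \<Rightarrow> real^'m"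
  by (rule bounded_bilinear_matrix_vector_mult)

lemma bounded_bilinear_cross3: "bounded_bilinear cross3"
  using bilinear_cross by (simp add: bilinear_conv_bounded_bilinear)

interpretation cross: bounded_bilinear cross3
  by (rule bounded_bilinear_cross3)

lemma bounded_linear_hat: "bounded_linear hat"
  by (rule linear_conv_bounded_linear[THEN iffD1])
    (auto simp: linear_iff hat_def matrix_def vec_eq_iff cross.add_left cross.scaleR_left)

lemmas hat_scaleR = linear_scale[OF bounded_linear.linear[OF bounded_linear_hat]]

lemma bounded_linear_vee: "bounded_linear vee"
  by (rule linear_conv_bounded_linear[THEN iffD1])
    (auto simp: linear_iff vee_def vec_eq_iff forall_3)

lemmas vee_add = linear_add[OF bounded_linear.linear[OF bounded_linear_vee]]
  and vee_scaleR = linear_scale[OF bounded_linear.linear[OF bounded_linear_vee]]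

lemma bounded_linear_transpose: "bounded_linear (transpose :: real^'n^'m \<Rightarrow> real^'m^'n)"
  by (rule linear_conv_bounded_linear[THEN iffD1])
    (auto simp: linear_iff transpose_def vec_eq_iff)

lemmas transpose_add = linear_add[OF bounded_linear.linear[OF bounded_linear_transpose]]
  and transpose_scaleR = linear_scale[OF bounded_linear.linear[OF bounded_linear_transpose]]

text \<open>A one-sided inverse of a square matrix is two-sided and unique, so the choice inside
  \<open>matrix_inv\<close> is forced.\<close>

lemma matrix_inv_eqI:
  fixes A B :: "real^'n^'n"
  assumes "A ** B = mat 1"
  shows "matrix_inv A = B"
proof -
  have BA: "B ** A = mat 1"
    using assms by (simp add: matrix_left_right_inverse)
  then have "\<exists>A'. A ** A' = mat 1 \<and> A' ** A = mat 1"
    using assms by blast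
  then have "A ** matrix_inv A = mat 1"
    unfolding matrix_inv_def by (rule someI2_ex) simp
  then show ?thesis
    using BA by (metis matrix_mul_assoc matrix_mul_lid matrix_mul_rid)
qed

lemma matrix_inv_orthogonal: "orthogonal_matrix Q \<Longrightarrow> matrix_inv Q = transpose Q"
  for Q :: "real^'n^'n"
  by (rule matrix_inv_eqI) (simp add: orthogonal_matrix_def)

section \<open>Skew matrices and their Cayley transforms\<close>

lemma transpose_hat: "transpose (hat w) = - hat w"
  by (simp add: hat_def matrix_def transpose_def cross3_simps axis_def forall_3)

text \<open>On vectors orthogonal to \<open>w\<close>, applying \<open>cross3 w\<close> twice is
  multiplication by \<open>- (w \<bullet> w)\<close>, and every \<open>cross3 w x\<close> is
  orthogonal to \<open>w\<close>. By this Cayley-Hamilton relation each polynomial in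
  \<open>hat w\<close> reduces to degree at most 2.\<close>

lemma hat_cube: "hat w ** hat w ** hat w = - (w \<bullet> w) *\<^sub>R hat w"
proof -
  have "cross3 w (cross3 w (cross3 w x)) = - (w \<bullet> w) *\<^sub>R cross3 w x" for x
    by (simp add: cross3_simps forall_3)
  then show ?thesis
    by (simp add: matrix_eq matrix_vector_mul_assoc[symmetric] hat_mult matvec.scaleR_left
        matvec.minus_left)
qed

text \<open>Orthogonal maps of determinant 1 preserve the cross product, so conjugating a skew
  matrix amounts to rotating its axis vector.\<close>

lemma hat_rotate:
  assumes "rotation_matrix A"
  shows "hat (transpose A *v w) = transpose A ** hat w ** A"
proof -
  have *: "A ** transpose A = mat 1" "transpose A ** A = mat 1" "det A = 1"
    using assms by (auto simp: rotation_matrix_def orthogonal_matrix_def)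
  have "A *v (transpose A *v w) = w"
    using *(1) by (simp add: matrix_vector_mul_assoc del: transpose_matrix_vector)
  then have "A *v cross3 (transpose A *v w) x = cross3 w (A *v x)" for x
    using cross_rotation_matrix[OF assms, of "transpose A *v w" x] by simp
  then have "transpose A *v (A *v cross3 (transpose A *v w) x) = transpose A *v cross3 w (A *v x)" for x
    by simp
  then show ?thesis
    using *(2) by (simp add: matrix_eq hat_mult matrix_vector_mul_assoc del: transpose_matrix_vector)
      (simp add: matrix_vector_mul_assoc[symmetric] hat_mult del: transpose_matrix_vector)
qed

lemmas matrix_expand = matmul.add_left matmul.add_right matmul.diff_left matmul.diff_right
  matmul.minus_left matmul.minus_right matmul.scaleR_left matmul.scaleR_right matrix_mul_assoc

lemma cay_hat:
  "cay (hat w) = mat 1 + (4 / (4 + w \<bullet> w)) *\<^sub>R (hat w + (1/2) *\<^sub>R (hat w ** hat w))"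
proof -
  define c where "c = 4 / (4 + w \<bullet> w)"
  define K where "K = hat w"
  have K3: "K ** K ** K = - (w \<bullet> w) *\<^sub>R K"
    unfolding K_def by (rule hat_cube)
  have pos: "4 + w \<bullet> w > 0"
    by (simp add: add_pos_nonneg)
  have c: "c * (4 + w \<bullet> w) = 4"
    using pos unfolding c_def by (metis less_numeral_extra(3) nonzero_eq_divide_eq)
  \<comment> \<open>The inverse is sought in the form I + \<alpha> K + \<beta> K^2. As K^3 = -|w|^2
    K, the K^2 coefficient forces \<beta> = \<alpha>/2 and then the K coefficient forces \<alpha> =
    c/2.\<close>
  have "(mat 1 - (1/2) *\<^sub>R K) ** (mat 1 + (c/2) *\<^sub>R K + (c/4) *\<^sub>R (K ** K))
     = mat 1 + (c/2 + c * (w \<bullet> w) / 8 - 1/2) *\<^sub>R K"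
    by (simp add: matrix_expand K3) (simp add: vec_eq_iff algebra_simps)
  also have "c/2 + c * (w \<bullet> w) / 8 - 1/2 = 0"
    using c by (simp add: algebra_simps)
  finally have inv: "matrix_inv (mat 1 - (1/2) *\<^sub>R K) = mat 1 + (c/2) *\<^sub>R K + (c/4) *\<^sub>R (K ** K)"
    by (intro matrix_inv_eqI) simp
  have "(mat 1 + (c/2) *\<^sub>R K + (c/4) *\<^sub>R (K ** K)) ** (mat 1 + (1/2) *\<^sub>R K)
     = mat 1 + (1/2 + c/2 - c * (w \<bullet> w) / 8) *\<^sub>R K + (c/2) *\<^sub>R (K ** K)"
    by (simp add: matrix_expand K3) (simp add: vec_eq_iff algebra_simps)
  also have "1/2 + c/2 - c * (w \<bullet> w) / 8 = c"
    using c by (simp add: algebra_simps)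
  finally show ?thesis
    unfolding cay_def inv[unfolded K_def] c_def[symmetric] K_def
    by (simp add: scaleR_add_right)
qed

lemma cay_hat_scaleR:
  "cay (\<epsilon> *\<^sub>R hat w) = mat 1 + (4 / (4 + \<epsilon>\<^sup>2 * (w \<bullet> w))) *\<^sub>R
     (\<epsilon> *\<^sub>R hat w + (\<epsilon>\<^sup>2 / 2) *\<^sub>R (hat w ** hat w))"
  using cay_hat[of "\<epsilon> *\<^sub>R w"]
  by (simp add: hat_scaleR matmul.scaleR_left matmul.scaleR_right power2_eq_square ac_simps)

text \<open>Transposition flips the sign of K and keeps K^2, so the odd powers cancel in the
  product; the value of c removes the remaining K^2 term. This allows the numerical rotation to be
  inverted by transposing it.\<close>

lemma orthogonal_cay_hat: "orthogonal_matrix (cay (hat w))"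
proof -
  define c where "c = 4 / (4 + w \<bullet> w)"
  define K where "K = hat w"
  have K3: "K ** K ** K = - (w \<bullet> w) *\<^sub>R K"
    unfolding K_def by (rule hat_cube)
  have pos: "4 + w \<bullet> w > 0"
    by (simp add: add_pos_nonneg)
  have "c * (4 + w \<bullet> w) = 4"
    using pos unfolding c_def by (metis less_numeral_extra(3) nonzero_eq_divide_eq)
  \<comment> \<open>The product below is quadratic in c, so the relation defining c is multiplied by
    c once more.\<close>
  then have "c * (c * (4 + w \<bullet> w)) = c * 4"
    by simp
  then have c: "c\<^sup>2 * (w \<bullet> w) = 4 * c - 4 * c\<^sup>2"
    by (simp add: algebra_simps power2_eq_square)
  have tr: "transpose (K ** K) = K ** K" "transpose K = - K"
    unfolding K_def by (simp_all add: transpose_hat matrix_transpose_mul matmul.minus_left matmul.minus_right)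
  have "transpose (mat 1 + c *\<^sub>R (K + (1/2) *\<^sub>R (K ** K))) ** (mat 1 + c *\<^sub>R (K + (1/2) *\<^sub>R (K ** K)))
      = mat 1 + (c - c\<^sup>2 - c\<^sup>2 * (w \<bullet> w) / 4) *\<^sub>R (K ** K)"
    by (simp add: transpose_add transpose_scaleR tr matrix_expand K3)
      (simp add: vec_eq_iff algebra_simps power2_eq_square)
  also have "c - c\<^sup>2 - c\<^sup>2 * (w \<bullet> w) / 4 = 0"
    using c by simp
  finally show ?thesis
    unfolding orthogonal_matrix cay_hat K_def c_def by simp
qed


section \<open>Differentiability and calculus of variations\<close>

lemma Ck_on_SucD:
  assumes "Ck_on (Suc k) f S" "open S" "x \<in> S"
  shows "(f has_derivative frechet_derivative f (at x)) (at x)"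
  using assms by (simp add: differentiable_on_eq_differentiable_at frechet_derivative_works)

text \<open>On an open set the two functions agree near each point, so their derivatives agree as
  well and the induction can descend through \<open>frechet_derivative\<close>.\<close>

lemma Ck_on_cong:
  assumes "Ck_on k f S" "open S" "\<And>x. x \<in> S \<Longrightarrow> f x = g x"
  shows "Ck_on k g S"
  using assms
proof (induction k arbitrary: f g)
  case 0
  then show ?case
    by (auto intro: continuous_on_eq)
next
  case (Suc k)
  have d: "(g has_derivative frechet_derivative f (at x)) (at x)" if "x \<in> S" for x
    using Ck_on_SucD[OF Suc.prems(1,2) that] Suc.prems(2,3) that
    by (blast intro: has_derivative_transform_within_open)
  then have "g differentiable_on S"
    using Suc.prems(2) by (auto simp: differentiable_on_eq_differentiable_at differentiable_def)
  moreover have "Ck_on k (\<lambda>x. frechet_derivative g (at x) v) S" for v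
  proof (rule Suc.IH[OF _ Suc.prems(2)])
    show "Ck_on k (\<lambda>x. frechet_derivative f (at x) v) S"
      using Suc.prems(1) by simp
    show "frechet_derivative f (at x) v = frechet_derivative g (at x) v" if "x \<in> S" for x
      using frechet_derivative_at[OF d[OF that]] by simp
  qed
  ultimately show ?case
    by simp
qed

text \<open>By uniqueness of derivatives any explicit \<open>f'\<close> may stand for the chosen
  \<open>frechet_derivative\<close>; the closure rules for sums, products and compositions rest on
  this form.\<close>

lemma Ck_on_SucI:
  assumes "open S" "\<And>x. x \<in> S \<Longrightarrow> (f has_derivative f' x) (at x)"
    and "\<And>v. Ck_on k (\<lambda>x. f' x v) S"
  shows "Ck_on (Suc k) f S"
proof -
  have "f differentiable_on S"
    using assms(1,2) by (auto simp: differentiable_on_eq_differentiable_at differentiable_def)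
  moreover have "Ck_on k (\<lambda>x. frechet_derivative f (at x) v) S" for v
    using assms(3)[of v] assms(1)
    by (rule Ck_on_cong) (simp add: frechet_derivative_at[OF assms(2), symmetric])
  ultimately show ?thesis
    by simp
qed

lemma Ck_on_Suc_imp: "Ck_on (Suc k) f S \<Longrightarrow> Ck_on k f S"
proof (induction k arbitrary: f)
  case 0
  then show ?case
    by (simp add: differentiable_imp_continuous_on)
next
  case (Suc k)
  have f: "f differentiable_on S" "Ck_on (Suc k) (\<lambda>x. frechet_derivative f (at x) v) S" for v
    using Suc.prems by (simp_all only: Ck_on.simps(2)[of "Suc k"])
  show ?case
    unfolding Ck_on.simps(2) using f(1) Suc.IH[OF f(2)] by blast
qed

lemma Ck_on_const: "Ck_on k (\<lambda>x. c) S"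
  by (induction k arbitrary: c) auto

lemma Ck_on_bounded_linear:
  assumes "bounded_linear f" "open S"
  shows "Ck_on k f S"
proof (cases k)
  case 0
  then show ?thesis
    using assms by (simp add: bounded_linear.linear linear_continuous_on)
next
  case (Suc m)
  show ?thesis
    unfolding Suc using assms
    by (intro Ck_on_SucI[where f' = "\<lambda>_. f"] Ck_on_const bounded_linear_imp_has_derivative)
qed

lemma Ck_on_add:
  assumes "Ck_on k f S" "Ck_on k g S" "open S"
  shows "Ck_on k (\<lambda>x. f x + g x) S"
  using assms
proof (induction k arbitrary: f g)
  case 0
  then show ?case
    by (auto intro: continuous_on_add)
next
  case (Suc k)
  show ?case
    using Suc.prems
    by (intro Ck_on_SucI[OF _ has_derivative_add[OF Ck_on_SucD[of k] Ck_on_SucD[of k]]] Suc.IH) simp_all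
qed

lemma Ck_on_bilinear:
  assumes "bounded_bilinear h" "Ck_on k f S" "Ck_on k g S" "open S"
  shows "Ck_on k (\<lambda>x. h (f x) (g x)) S"
  using assms(2-)
proof (induction k arbitrary: f g)
  case 0
  then show ?case
    using assms(1) by (auto intro: bounded_bilinear.continuous_on)
next
  case (Suc k)
  show ?case
    \<comment> \<open>The product rule pairs each factor with the derivative of the other, so the
      undifferentiated factors are also needed at level \<open>k\<close>.\<close>
    using Suc.prems Suc.prems(1,2)[THEN Ck_on_Suc_imp]
    by (intro Ck_on_SucI[OF _ bounded_bilinear.FDERIV[OF assms(1) Ck_on_SucD[of k] Ck_on_SucD[of k]]]
        Ck_on_add Suc.IH) simp_all
qed

text \<open>For a linear inner map the direction \<open>g v\<close> does not depend on the point, so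
  the derivative is again a function composed with \<open>g\<close> and the induction closes. This
  lifts functions of time to functions of the pair (s, t).\<close>

lemma Ck_on_compose_bounded_linear:
  assumes "Ck_on k f T" "bounded_linear g" "g ` S \<subseteq> T" "open S" "open T"
  shows "Ck_on k (\<lambda>x. f (g x)) S"
  using assms(1)
proof (induction k arbitrary: f)
  case 0
  then have "continuous_on T f"
    by simp
  moreover have "continuous_on S g"
    using assms(2) by (simp add: bounded_linear.linear linear_continuous_on)
  ultimately show ?case
    using assms(3) by (auto intro: continuous_on_compose2)
next
  case (Suc k)
  have "((\<lambda>x. f (g x)) has_derivative (\<lambda>v. frechet_derivative f (at (g x)) (g v))) (at x)"
    if "x \<in> S" for x
    using has_derivative_compose[OF bounded_linear_imp_has_derivative[OF assms(2)] Ck_on_SucD[OF Suc.prems assms(5)]]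
      that assms(3) by blast
  moreover have "Ck_on k (\<lambda>x. frechet_derivative f (at (g x)) (g v)) S" for v
    using Suc.prems by (intro Suc.IH[where f = "\<lambda>y. frechet_derivative f (at y) (g v)"]) simp
  ultimately show ?case
    using assms(4) by (intro Ck_on_SucI)
qed

text \<open>The two claims are proved together because the derivative of each function involves the
  other.\<close>

lemma Ck_on_sin_cos:
  fixes f :: "'a::euclidean_space \<Rightarrow> real"
  assumes "Ck_on k f S" "open S"
  shows "Ck_on k (\<lambda>x. sin (f x)) S \<and> Ck_on k (\<lambda>x. cos (f x)) S"
  using assms(1)
proof (induction k arbitrary: f)
  case 0
  then show ?case
    by (auto intro: continuous_intros)
next
  case (Suc k)
  note IH = Suc.IH[OF Ck_on_Suc_imp[OF Suc.prems]]
  have f': "Ck_on k (\<lambda>x. frechet_derivative f (at x) v) S" for v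
    using Suc.prems by simp
  have "Ck_on (Suc k) (\<lambda>x. sin (f x)) S"
  proof (rule Ck_on_SucI[OF assms(2)])
    fix x assume "x \<in> S"
    show "((\<lambda>x. sin (f x)) has_derivative (\<lambda>v. cos (f x) * frechet_derivative f (at x) v)) (at x)"
      using has_derivative_sin[OF Ck_on_SucD[OF Suc.prems assms(2) \<open>x \<in> S\<close>]]
      by (simp add: ac_simps)
  qed (intro Ck_on_bilinear[OF bounded_bilinear_mult] f' IH[THEN conjunct2] assms(2))
  moreover have "Ck_on (Suc k) (\<lambda>x. cos (f x)) S"
  proof (rule Ck_on_SucI[OF assms(2)])
    fix x assume "x \<in> S"
    show "((\<lambda>x. cos (f x)) has_derivative
        (\<lambda>v. sin (f x) * (-1 * frechet_derivative f (at x) v))) (at x)"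
      using has_derivative_cos[OF Ck_on_SucD[OF Suc.prems assms(2) \<open>x \<in> S\<close>]]
      by (simp add: ac_simps)
  qed (intro Ck_on_bilinear[OF bounded_bilinear_mult] Ck_on_const f' IH[THEN conjunct1] assms(2))
  ultimately show ?case
    by blast
qed

section \<open>Curves: derivatives, Taylor remainder and test functions\<close>

lemma Ck_on_real_has_vector_derivative:
  fixes f :: "real \<Rightarrow> 'b::real_normed_vector"
  assumes "Ck_on (Suc k) f S" "open S" "t \<in> S"
  shows "(f has_vector_derivative vector_derivative f (at t)) (at t)"
proof -
  have "f differentiable at t"
    using Ck_on_SucD[OF assms] by (rule differentiableI)
  then show ?thesis
    by (simp add: vector_derivative_works)
qed

lemma Ck_on_vector_derivative:
  fixes f :: "real \<Rightarrow> 'b::real_normed_vector"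
  assumes "Ck_on (Suc k) f S" "open S"
  shows "Ck_on k (\<lambda>t. vector_derivative f (at t)) S"
proof (rule Ck_on_cong[OF _ assms(2)])
  show "Ck_on k (\<lambda>t. frechet_derivative f (at t) 1) S"
    using assms(1) by simp
  show "frechet_derivative f (at t) 1 = vector_derivative f (at t)" if "t \<in> S" for t
    using Ck_on_SucD[OF assms that]
    by (subst frechet_derivative_eq_vector_derivative) (auto simp: differentiable_def)
qed

text \<open>Differentiability of \<open>f'\<close> at the single point \<open>t\<close> bounds its
  increment from \<open>t\<close> linearly; the mean value inequality then makes the remainder of
  \<open>f\<close> quadratic.\<close>

lemma first_order_remainder_bigo:
  fixes f :: "real \<Rightarrow> 'b::real_normed_vector"
  assumes "open S" "t \<in> S" and f: "\<And>s. s \<in> S \<Longrightarrow> (f has_vector_derivative f' s) (at s)"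
    and f': "(f' has_vector_derivative f'') (at t)"
  shows "(\<lambda>\<epsilon>. norm (f (t + \<epsilon>) - f t - \<epsilon> *\<^sub>R f' t)) \<in> O[at_right 0](\<lambda>\<epsilon>. \<epsilon> ^ 2)"
proof -
  obtain d1 where d1: "d1 > 0" "\<And>s. \<bar>s - t\<bar> < d1 \<Longrightarrow> s \<in> S"
    using assms(1,2) by (auto simp: open_dist dist_real_def)
  obtain d2 where d2: "d2 > 0"
    "\<And>s. \<bar>s - t\<bar> < d2 \<Longrightarrow> norm (f' s - f' t - (s - t) *\<^sub>R f'') \<le> 1 * norm (s - t)"
    using f' zero_less_one unfolding has_vector_derivative_def has_derivative_at_alt real_norm_def
    by blast
  \<comment> \<open>The summand 1 is the tolerance chosen in the linearization of \<open>f'\<close>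
    just above.\<close>
  define B where "B = norm f'' + 1"
  have lip: "norm (f' s - f' t) \<le> B * \<bar>s - t\<bar>" if "\<bar>s - t\<bar> < d2" for s
  proof -
    have "norm (f' s - f' t) \<le> norm (f' s - f' t - (s - t) *\<^sub>R f'') + norm ((s - t) *\<^sub>R f'')"
      by (metis diff_add_cancel norm_triangle_ineq)
    also have "\<dots> \<le> B * \<bar>s - t\<bar>"
      using d2(2)[OF that] by (simp add: B_def distrib_left distrib_right mult.commute)
    finally show ?thesis .
  qed
  have "norm (f (t + \<epsilon>) - f t - \<epsilon> *\<^sub>R f' t) \<le> B * \<epsilon> ^ 2" if "0 < \<epsilon>" "\<epsilon> < min d1 d2" for \<epsilon>
  proof -
    have "norm (f (t + \<epsilon>) - f t - ((t + \<epsilon>) - t) *\<^sub>R f' t) \<le> norm ((t + \<epsilon>) - t) * (B * \<epsilon>)"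
    proof (rule vector_differentiable_bound_linearization[where S = "{t..t + \<epsilon>}"])
      show "(f has_vector_derivative f' s) (at s within {t..t + \<epsilon>})" if "s \<in> {t..t + \<epsilon>}" for s
        using f[of s] d1(2)[of s] that \<open>\<epsilon> < min d1 d2\<close> by (auto intro: has_vector_derivative_at_within)
      show "norm (f' s - f' t) \<le> B * \<epsilon>" if "s \<in> {t..t + \<epsilon>}" for s
      proof -
        have "norm (f' s - f' t) \<le> B * \<bar>s - t\<bar>"
          using that \<open>\<epsilon> < min d1 d2\<close> by (intro lip) auto
        also have "\<dots> \<le> B * \<epsilon>"
          using that by (intro mult_left_mono) (auto simp: B_def)
        finally show ?thesis .
      qed
    qed (use that in \<open>auto simp: closed_segment_eq_real_ivl\<close>)
    then show ?thesis
      using that by (simp add: power2_eq_square ac_simps)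
  qed
  then have "eventually (\<lambda>\<epsilon>. norm (f (t + \<epsilon>) - f t - \<epsilon> *\<^sub>R f' t) \<le> B * \<epsilon> ^ 2) (at_right 0)"
    using d1(1) d2(1) by (intro eventually_at_rightI[of 0 "min d1 d2"]) auto
  then show ?thesis
    by (intro bigoI[where c = B]) (auto elim: eventually_mono)
qed

text \<open>Since the interval varies, a parabola positive inside it serves as test function: where
  \<open>g\<close> is positive on a small interval, the weighted integral would be positive.\<close>

lemma fundamental_lemma_variations:
  fixes g :: "real \<Rightarrow> real"
  assumes "open S" "continuous_on S g"
    and vanish: "\<And>a b. a < b \<Longrightarrow> {a..b} \<subseteq> S \<Longrightarrow>
      integral {a..b} (\<lambda>t. (t - a) * (b - t) * g t) = 0"
    and "t \<in> S"
  shows "g t = 0"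
proof -
  \<comment> \<open>One sign suffices: the claim is applied to \<open>g\<close> and to its
    negative.\<close>
  have le: "h t \<le> 0" if h: "continuous_on S h"
    and hv: "\<And>a b. a < b \<Longrightarrow> {a..b} \<subseteq> S \<Longrightarrow> integral {a..b} (\<lambda>t. (t - a) * (b - t) * h t) = 0"
    for h :: "real \<Rightarrow> real"
  proof (rule ccontr)
    assume "\<not> h t \<le> 0"
    moreover have "isCont h t"
      using h assms(1,4) by (simp add: continuous_on_eq_continuous_at)
    ultimately have "eventually (\<lambda>s. h s > 0 \<and> s \<in> S) (nhds t)"
      using assms(1,4) by (intro eventually_conj)
        (auto intro: order_tendstoD eventually_nhds_in_open simp: isCont_def tendsto_at_iff_tendsto_nhds)
    then obtain d where d: "d > 0" "\<And>s. \<bar>s - t\<bar> < d \<Longrightarrow> h s > 0 \<and> s \<in> S"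
      unfolding eventually_nhds_metric by (auto simp: dist_real_def)
    \<comment> \<open>Half the radius keeps the closed interval inside the ball on which
      \<open>h\<close> is positive.\<close>
    define a b where "a = t - d / 2" and "b = t + d / 2"
    have ab: "a < b" "{a..b} \<subseteq> S"
      using d by (auto simp: a_def b_def abs_if)
    have "integral {a..b} (\<lambda>t. 0) < integral {a..b} (\<lambda>t. (t - a) * (b - t) * h t)"
    proof (rule integral_less_real)
      show "continuous_on {a..b} (\<lambda>t. (t - a) * (b - t) * h t)"
        using continuous_on_subset[OF h ab(2)] by (intro continuous_intros)
      show "0 < (s - a) * (b - s) * h s" if "s \<in> {a<..<b}" for s
        using that d(2)[of s] d(1) by (auto simp: a_def b_def abs_if intro!: mult_pos_pos)
    qed (use ab in auto)
    with hv[OF ab] show False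
      by simp
  qed
  show ?thesis
    using le[of g] le[of "\<lambda>t. - g t"] assms(2) vanish
    by (simp add: continuous_on_minus)
qed


section \<open>From the Lagrange-d'Alembert principle to the Suslov equations\<close>

text \<open>Rodrigues' formula for the exponential of \<theta> times \<open>hat (axis i 1)\<close>,
  the rotation by \<theta> about a coordinate axis.\<close>

definition rot :: "3 \<Rightarrow> real \<Rightarrow> real^3^3" where
  "rot i \<theta> = mat 1 + sin \<theta> *\<^sub>R hat (axis i 1)
     + (1 - cos \<theta>) *\<^sub>R (hat (axis i 1) ** hat (axis i 1))"

lemma hat_axis_cube: "hat (axis i 1) ** hat (axis i 1) ** hat (axis i 1) = - hat (axis i 1)"
  by (simp add: hat_cube inner_axis_axis)

lemma rotation_matrix_rot: "rotation_matrix (rot i \<theta>)"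
proof -
  define K where "K = hat (axis i 1)"
  define s c where "s = sin \<theta>" and "c = cos \<theta>"
  have K3: "K ** K ** K = - K"
    unfolding K_def by (rule hat_axis_cube)
  have sc: "s * s = 1 - c * c"
    using sin_squared_eq[of \<theta>] by (simp add: s_def c_def power2_eq_square)
  have tr: "transpose (K ** K) = K ** K" "transpose K = - K"
    unfolding K_def
    by (simp_all add: transpose_hat matrix_transpose_mul matmul.minus_left matmul.minus_right)
  have "transpose (mat 1 + s *\<^sub>R K + (1 - c) *\<^sub>R (K ** K)) ** (mat 1 + s *\<^sub>R K + (1 - c) *\<^sub>R (K ** K))
     = mat 1 + (1 - c * c - s * s) *\<^sub>R (K ** K)"
    by (simp add: transpose_add transpose_scaleR tr matrix_expand K3)
      (simp add: vec_eq_iff algebra_simps)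
  then have "orthogonal_matrix (rot i \<theta>)"
    unfolding orthogonal_matrix rot_def K_def[symmetric] s_def[symmetric] c_def[symmetric] sc
    by simp
  moreover have "det (rot i \<theta>) = 1"
    using sin_cos_squared_add[of \<theta>] exhaust_3[of i]
    by (auto simp: det_3 rot_def hat_def matrix_def matrix_matrix_mult_def sum_3 cross3_def axis_def
        mat_def power2_eq_square algebra_simps)
  ultimately show ?thesis
    by (simp add: rotation_matrix_def)
qed

lemma rot_0 [simp]: "rot i 0 = mat 1"
  by (simp add: rot_def)

text \<open>The generator is placed on the right, which suits velocities read in the body
  frame.\<close>

lemma has_vector_derivative_rot:
  "(rot i has_vector_derivative rot i \<theta> ** hat (axis i 1)) (at \<theta>)"
proof -
  have "((\<lambda>\<theta>. mat 1 + sin \<theta> *\<^sub>R hat (axis i 1)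
     + (1 - cos \<theta>) *\<^sub>R (hat (axis i 1) ** hat (axis i 1))) has_vector_derivative
     cos \<theta> *\<^sub>R hat (axis i 1) + sin \<theta> *\<^sub>R (hat (axis i 1) ** hat (axis i 1))) (at \<theta>)"
    by (auto intro!: derivative_eq_intros)
  moreover have "rot i \<theta> ** hat (axis i 1)
      = cos \<theta> *\<^sub>R hat (axis i 1) + sin \<theta> *\<^sub>R (hat (axis i 1) ** hat (axis i 1))"
    by (simp add: rot_def matrix_expand hat_axis_cube) (simp add: vec_eq_iff algebra_simps)
  ultimately show ?thesis
    by (simp add: rot_def[abs_def])
qed

lemma transpose_rot_mult:
  "transpose (rot i \<theta>) *v x = x - sin \<theta> *\<^sub>R cross3 (axis i 1) x
     + (1 - cos \<theta>) *\<^sub>R cross3 (axis i 1) (cross3 (axis i 1) x)"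
  by (simp add: rot_def transpose_add transpose_scaleR transpose_hat matrix_transpose_mul
      matmul.minus_left matmul.minus_right matvec.add_left matvec.diff_left matvec.scaleR_left
      matvec.minus_left matrix_vector_mul_assoc[symmetric] hat_mult del: transpose_matrix_vector)

lemma Ck_on_rot:
  assumes "Ck_on k f S" "open S"
  shows "Ck_on k (\<lambda>x. rot i (f x)) S"
proof -
  \<comment> \<open>The difference is written as a sum with a factor -1 so that the sum and product
    rules apply directly.\<close>
  have "Ck_on k (\<lambda>x. mat 1 + sin (f x) *\<^sub>R hat (axis i 1)
     + (1 + (-1) * cos (f x)) *\<^sub>R (hat (axis i 1) ** hat (axis i 1))) S"
    using Ck_on_sin_cos[OF assms] assms(2)
    by (intro Ck_on_add Ck_on_const Ck_on_bilinear[OF bounded_bilinear_scaleR]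
        Ck_on_bilinear[OF bounded_bilinear_mult]) blast+
  then show ?thesis
    by (simp add: rot_def)
qed

text \<open>With the transpose in place of \<open>matrix_inv\<close> the map is bilinear, hence open
  to the product rules; on orthogonal matrices the two agree.\<close>

definition body_velocity :: "real^3^3 \<Rightarrow> real^3^3 \<Rightarrow> real^3" where
  "body_velocity A V = vee (transpose A ** V)"

lemma bounded_bilinear_body_velocity: "bounded_bilinear body_velocity"
  unfolding bilinear_conv_bounded_bilinear[symmetric] bilinear_def linear_iff body_velocity_def
  by (simp add: transpose_add transpose_scaleR matmul.add_left matmul.add_right matmul.scaleR_left
      matmul.scaleR_right vee_add vee_scaleR)

lemma body_velocity_eq: "orthogonal_matrix A \<Longrightarrow> vee (matrix_inv A ** V) = body_velocity A V"
  by (simp add: body_velocity_def matrix_inv_orthogonal)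

lemma body_velocity_hat: "orthogonal_matrix A \<Longrightarrow> body_velocity A (A ** hat x) = x"
  by (simp add: body_velocity_def matrix_mul_assoc orthogonal_matrix)

text \<open>Symmetry of \<open>J\<close> enters when the kinetic energy is differentiated along a
  variation.\<close>

locale unreduced_trajectory =
  fixes J :: "real^3^3" and T :: "real set" and R :: "real \<Rightarrow> real^3^3" and lam :: "real \<Rightarrow> real"
  assumes symmetric: "transpose J = J" and open_T: "open T" and solution: "unreduced_solution J T R lam"
begin

definition w :: "real \<Rightarrow> real^3" where
  "w t = body_velocity (R t) (vector_derivative R (at t))"

definition w' :: "real \<Rightarrow> real^3" where
  "w' t = vector_derivative w (at t)"

lemma C2: "Ck_on (Suc (Suc 0)) R T"
  using solution
  by (simp add: unreduced_solution_def lagrange_dalembert_solution_def numeral_2_eq_2 del: Ck_on.simps)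

lemma continuous_lam: "continuous_on T lam"
  using solution by (simp add: unreduced_solution_def lagrange_dalembert_solution_def)

lemma rotation: "t \<in> T \<Longrightarrow> rotation_matrix (R t)"
  using solution by (simp add: unreduced_solution_def lagrange_dalembert_solution_def)

lemma orthogonal: "t \<in> T \<Longrightarrow> orthogonal_matrix (R t)"
  using rotation by (simp add: rotation_matrix_def)

lemma reconstruction:
  assumes "t \<in> T"
  shows "vector_derivative R (at t) = R t ** hat (w t)" "w t $ 3 = 0"
proof -
  obtain x where x: "vector_derivative R (at t) = R t ** hat x" "x $ 3 = 0"
    using solution assms
    by (auto simp: unreduced_solution_def lagrange_dalembert_solution_def suslov_distribution_def)
  then have "w t = x"
    by (simp add: w_def body_velocity_hat orthogonal assms)
  with x show "vector_derivative R (at t) = R t ** hat (w t)" "w t $ 3 = 0"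
    by simp_all
qed

lemma R_derivative: "t \<in> T \<Longrightarrow> (R has_vector_derivative R t ** hat (w t)) (at t)"
  using Ck_on_real_has_vector_derivative[OF C2 open_T] by (simp add: reconstruction)

lemma C1_w: "Ck_on (Suc 0) w T"
  unfolding w_def[abs_def]
  by (intro Ck_on_bilinear[OF bounded_bilinear_body_velocity] Ck_on_Suc_imp[OF C2]
      Ck_on_vector_derivative[OF C2] open_T)

lemma w_derivative: "t \<in> T \<Longrightarrow> (w has_vector_derivative w' t) (at t)"
  unfolding w'_def by (rule Ck_on_real_has_vector_derivative[OF C1_w open_T])

lemma continuous_w': "continuous_on T w'"
  using Ck_on_vector_derivative[OF C1_w open_T] by (simp add: w'_def[abs_def])

lemma continuous_w: "continuous_on T w"
  using Ck_on_Suc_imp[OF C1_w] by simp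

section \<open>Variations by rotations about a coordinate axis\<close>

context
  fixes i :: 3 and \<phi> :: "real \<Rightarrow> real" and a b :: real
  assumes \<phi>: "Ck_on (Suc (Suc 0)) \<phi> T" "\<phi> a = 0" "\<phi> b = 0" and ab: "a < b" "{a..b} \<subseteq> T"
begin

abbreviation (input) "e \<equiv> axis i 1 :: real^3"

abbreviation (input) "\<phi>' t \<equiv> vector_derivative \<phi> (at t)"

definition Q :: "real \<times> real \<Rightarrow> real^3^3" where
  "Q = (\<lambda>(s, t). R t ** rot i (s * \<phi> t))"

text \<open>This is the body angular velocity of the varied curve (see
  \<open>body_velocity_Q\<close>), in closed form so that its \<open>s\<close>-derivative and joint
  continuity are explicit.\<close>

definition \<Omega> :: "real \<Rightarrow> real \<Rightarrow> real^3" where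
  "\<Omega> s t = w t - sin (s * \<phi> t) *\<^sub>R cross3 e (w t)
     + (1 - cos (s * \<phi> t)) *\<^sub>R cross3 e (cross3 e (w t)) + (s * \<phi>' t) *\<^sub>R e"

text \<open>The derivative of \<open>\<Omega>\<close> in \<open>s\<close>. At \<open>s\<close> = 0
  it is the classical formula \<delta>\<omega> = \<eta>' + \<omega> \<times> \<eta> with \<eta> =
  \<phi> e.\<close>

definition \<Omega>\<^sub>s :: "real \<Rightarrow> real \<Rightarrow> real^3" where
  "\<Omega>\<^sub>s s t = \<phi> t *\<^sub>R (sin (s * \<phi> t) *\<^sub>R cross3 e (cross3 e (w t)) - cos (s * \<phi> t) *\<^sub>R cross3 e (w t))
     + \<phi>' t *\<^sub>R e"

lemma \<phi>_derivative: "t \<in> T \<Longrightarrow> (\<phi> has_vector_derivative \<phi>' t) (at t)"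
  by (rule Ck_on_real_has_vector_derivative[OF \<phi>(1) open_T])

lemma rotation_Q: "t \<in> T \<Longrightarrow> rotation_matrix (Q (s, t))"
  using rotation[of t] rotation_matrix_rot[of i "s * \<phi> t"]
  by (simp add: Q_def rotation_matrix_def orthogonal_matrix_mul det_mul)

text \<open>The endpoints stay fixed because \<open>\<phi>\<close> vanishes there. \<open>Q\<close>
  is defined for every \<open>s\<close>, so the radius 1 is arbitrary.\<close>

lemma variation_Q: "fixed_endpoint_variation Q R T a b"
proof -
  let ?U = "{-1<..<1} \<times> T :: (real \<times> real) set"
  have opn: "open ?U"
    by (intro open_Times open_T) auto
  have "Ck_on 2 (\<lambda>x. R (snd x) ** rot i (fst x * \<phi> (snd x))) ?U"
    unfolding numeral_2_eq_2
    by (intro Ck_on_bilinear[OF bounded_bilinear_matrix_matrix_mult] Ck_on_rot opn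
        Ck_on_bilinear[OF bounded_bilinear_mult] Ck_on_bounded_linear[OF bounded_linear_fst]
        Ck_on_compose_bounded_linear[OF C2 bounded_linear_snd _ opn open_T]
        Ck_on_compose_bounded_linear[OF \<phi>(1) bounded_linear_snd _ opn open_T]) auto
  then have "Ck_on 2 Q ?U"
    by (simp add: Q_def case_prod_beta' del: Ck_on.simps)
  then show ?thesis
    unfolding fixed_endpoint_variation_def using rotation_Q \<phi>
    by (intro exI[of _ 1]) (auto simp: Q_def)
qed

text \<open>With Q = R E, the product rule gives Q^-1 Q' = E^T (R^-1 R') E + E^T E'. The first term
  is the rotated \<open>w\<close>, the second is the velocity of the angle along the axis.\<close>

lemma body_velocity_Q:
  assumes "t \<in> T"
  shows "vee (matrix_inv (Q (s, t)) ** vector_derivative (\<lambda>\<tau>. Q (s, \<tau>)) (at t)) = \<Omega> s t"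
proof -
  let ?E = "rot i (s * \<phi> t)"
  have "((\<lambda>\<tau>. s * \<phi> \<tau>) has_vector_derivative s * \<phi>' t) (at t)"
    by (intro has_vector_derivative_mult_right \<phi>_derivative assms)
  from vector_diff_chain_at[OF this has_vector_derivative_rot]
  have "((\<lambda>\<tau>. rot i (s * \<phi> \<tau>)) has_vector_derivative (s * \<phi>' t) *\<^sub>R (?E ** hat e)) (at t)"
    by (simp add: o_def)
  from matmul.has_vector_derivative[OF R_derivative[OF assms] this]
  have "vector_derivative (\<lambda>\<tau>. Q (s, \<tau>)) (at t)
      = R t ** ((s * \<phi>' t) *\<^sub>R (?E ** hat e)) + R t ** hat (w t) ** ?E"
    by (simp add: Q_def vector_derivative_at)
  moreover have "matrix_inv (Q (s, t)) = transpose ?E ** transpose (R t)"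
    using rotation_Q[OF assms] unfolding rotation_matrix_def
    by (simp add: matrix_inv_orthogonal) (simp add: Q_def matrix_transpose_mul)
  moreover have "transpose (R t) ** R t = mat 1" "transpose ?E ** ?E = mat 1"
    using rotation[OF assms] rotation_matrix_rot[of i "s * \<phi> t"]
    by (auto simp: rotation_matrix_def orthogonal_matrix)
  moreover have "transpose ?E ** (transpose (R t) ** (R t ** X)) = transpose ?E ** X" for X :: "real^3^3"
    using calculation(3) by (simp add: matrix_mul_assoc[of "transpose (R t)"])
  moreover have "transpose ?E ** (?E ** X) = X" for X :: "real^3^3"
    using calculation(4) by (simp add: matrix_mul_assoc)
  ultimately have "matrix_inv (Q (s, t)) ** vector_derivative (\<lambda>\<tau>. Q (s, \<tau>)) (at t)
      = (s * \<phi>' t) *\<^sub>R hat e + transpose ?E ** hat (w t) ** ?E"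
    by (simp add: matmul.add_right matmul.scaleR_right matrix_mul_assoc[symmetric])
  also have "transpose ?E ** hat (w t) ** ?E = hat (transpose ?E *v w t)"
    by (rule hat_rotate[OF rotation_matrix_rot, symmetric])
  finally show ?thesis
    by (simp add: vee_add vee_scaleR transpose_rot_mult \<Omega>_def del: transpose_matrix_vector)
qed

lemma annihilator_Q:
  assumes "t \<in> T"
  shows "suslov_annihilator (R t) (vector_derivative (\<lambda>s. Q (s, t)) (at 0)) = \<phi> t * (axis 3 1 \<bullet> e)"
proof -
  have "((\<lambda>s. s * \<phi> t) has_vector_derivative \<phi> t) (at 0)"
    by (auto intro!: derivative_eq_intros)
  from vector_diff_chain_at[OF this has_vector_derivative_rot]
  have "((\<lambda>s. rot i (s * \<phi> t)) has_vector_derivative \<phi> t *\<^sub>R hat e) (at 0)"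
    by (simp add: o_def)
  from matmul.has_vector_derivative[OF has_vector_derivative_const this, of "R t"]
  have "vector_derivative (\<lambda>s. Q (s, t)) (at 0) = R t ** hat (\<phi> t *\<^sub>R e)"
    by (simp add: Q_def vector_derivative_at hat_scaleR)
  then show ?thesis
    by (simp add: suslov_annihilator_def body_velocity_eq orthogonal assms body_velocity_hat)
qed

lemma \<Omega>_derivative: "((\<lambda>s. \<Omega> s t) has_vector_derivative \<Omega>\<^sub>s s t) (at s)"
  unfolding \<Omega>_def \<Omega>\<^sub>s_def
  by (auto intro!: derivative_eq_intros simp: algebra_simps)

text \<open>Differentiation under the integral sign; by symmetry of \<open>J\<close> the two terms
  of the product rule coincide and cancel the factor 1/2.\<close>

lemma first_variation:
  "((\<lambda>s. integral {a..b} (\<lambda>t. suslov_lagrangian J (Q (s, t)) (vector_derivative (\<lambda>\<tau>. Q (s, \<tau>)) (at t))))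
     has_real_derivative integral {a..b} (\<lambda>t. (J *v w t) \<bullet> \<Omega>\<^sub>s 0 t)) (at 0)"
proof -
  have cont: "continuous_on {a..b} w" "continuous_on {a..b} \<phi>" "continuous_on {a..b} \<phi>'"
    using continuous_w Ck_on_Suc_imp[OF Ck_on_Suc_imp[OF \<phi>(1)]]
      Ck_on_Suc_imp[OF Ck_on_vector_derivative[OF \<phi>(1) open_T]] ab(2)
    by (auto intro: continuous_on_subset)
  \<comment> \<open>The Leibniz rule asks for joint continuity, so functions of time are viewed as
    functions of (s, t).\<close>
  note cont_snd = cont[THEN continuous_on_compose2, OF continuous_on_snd[OF continuous_on_id]]
  have c\<Omega>: "continuous_on (UNIV \<times> {a..b}) (\<lambda>x. \<Omega> (fst x) (snd x))"
    "continuous_on (UNIV \<times> {a..b}) (\<lambda>x. \<Omega>\<^sub>s (fst x) (snd x))"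
    unfolding \<Omega>_def \<Omega>\<^sub>s_def
    by (auto intro!: continuous_intros cross.continuous_on cont_snd)
  have sym: "(J *v x) \<bullet> y = (J *v y) \<bullet> x" for x y
    by (metis symmetric dot_lmul_matrix inner_commute transpose_matrix_vector)
  have "((\<lambda>s. integral (cbox a b) (\<lambda>t. (1/2) * ((J *v \<Omega> s t) \<bullet> \<Omega> s t)))
     has_real_derivative integral (cbox a b) (\<lambda>t. (J *v \<Omega> 0 t) \<bullet> \<Omega>\<^sub>s 0 t)) (at 0 within UNIV)"
  proof (rule leibniz_rule_field_derivative)
    fix s t :: real
    have "((\<lambda>s. J *v \<Omega> s t) has_vector_derivative J *v \<Omega>\<^sub>s s t) (at s)"
      using matvec.has_vector_derivative[OF has_vector_derivative_const \<Omega>_derivative] by simp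
    from bounded_bilinear.has_vector_derivative[OF bounded_bilinear_inner this \<Omega>_derivative[of t]]
    have "((\<lambda>s. (J *v \<Omega> s t) \<bullet> \<Omega> s t) has_real_derivative 2 * ((J *v \<Omega> s t) \<bullet> \<Omega>\<^sub>s s t)) (at s)"
      by (simp add: has_real_derivative_iff_has_vector_derivative sym[of "\<Omega>\<^sub>s s t"])
    from DERIV_cmult[OF this, of "1/2"]
    show "((\<lambda>s. (1/2) * ((J *v \<Omega> s t) \<bullet> \<Omega> s t)) has_real_derivative (J *v \<Omega> s t) \<bullet> \<Omega>\<^sub>s s t) (at s within UNIV)"
      by simp
  next
    fix s :: real
    have "continuous_on {a..b} (\<lambda>t. (s, t))"
      by (intro continuous_intros)
    from continuous_on_compose2[OF c\<Omega>(1) this] have "continuous_on {a..b} (\<Omega> s)"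
      by auto
    then show "(\<lambda>t. (1/2) * ((J *v \<Omega> s t) \<bullet> \<Omega> s t)) integrable_on cbox a b"
      by (auto intro!: integrable_continuous_real continuous_intros matvec.continuous_on)
  next
    show "continuous_on (UNIV \<times> cbox a b) (\<lambda>(s, t). (J *v \<Omega> s t) \<bullet> \<Omega>\<^sub>s s t)"
      using c\<Omega> by (auto intro!: continuous_intros matvec.continuous_on simp: case_prod_beta')
  qed auto
  moreover have "integral {a..b} (\<lambda>t. suslov_lagrangian J (Q (s, t)) (vector_derivative (\<lambda>\<tau>. Q (s, \<tau>)) (at t)))
      = integral {a..b} (\<lambda>t. (1/2) * ((J *v \<Omega> s t) \<bullet> \<Omega> s t))" for s
    using ab(2) by (intro integral_cong) (simp add: suslov_lagrangian_def body_velocity_Q subset_eq Let_def)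
  moreover have "\<Omega> 0 t = w t" for t
    by (simp add: \<Omega>_def)
  ultimately show ?thesis
    by (simp only: box_real)
qed

text \<open>Integration by parts moves the derivative from \<open>\<phi>\<close> to the momentum
  \<open>J *v w t\<close>; the boundary terms vanish with \<open>\<phi>\<close>.\<close>

lemma tested_equation:
  "integral {a..b} (\<lambda>t. \<phi> t * ((cross3 (J *v w t) (w t) + lam t *\<^sub>R axis 3 1 - J *v w' t) \<bullet> e)) = 0"
proof -
  have sub: "t \<in> T" if "t \<in> {a..b}" for t
    using that ab(2) by blast
  have cont: "continuous_on {a..b} w" "continuous_on {a..b} w'" "continuous_on {a..b} lam"
      "continuous_on {a..b} \<phi>" "continuous_on {a..b} \<phi>'"
    using continuous_w continuous_w' continuous_lam Ck_on_Suc_imp[OF Ck_on_Suc_imp[OF \<phi>(1)]]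
      Ck_on_Suc_imp[OF Ck_on_vector_derivative[OF \<phi>(1) open_T]] ab(2)
    by (auto intro: continuous_on_subset)
  have "((\<lambda>s. integral {a..b} (\<lambda>t. suslov_lagrangian J (Q (s, t)) (vector_derivative (\<lambda>\<tau>. Q (s, \<tau>)) (at t))))
      has_real_derivative - integral {a..b} (\<lambda>t. lam t *
        suslov_annihilator (R t) (vector_derivative (\<lambda>s. Q (s, t)) (at 0)))) (at 0)"
    using solution variation_Q ab
    unfolding unreduced_solution_def lagrange_dalembert_solution_def by blast
  moreover have "integral {a..b} (\<lambda>t. lam t * suslov_annihilator (R t) (vector_derivative (\<lambda>s. Q (s, t)) (at 0)))
      = integral {a..b} (\<lambda>t. lam t * (\<phi> t * (axis 3 1 \<bullet> e)))"
    by (intro integral_cong) (simp add: annihilator_Q sub)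
  \<comment> \<open>The principle and \<open>first_variation\<close> give two values of the same
    derivative, which must be equal.\<close>
  ultimately have 1: "integral {a..b} (\<lambda>t. (J *v w t) \<bullet> \<Omega>\<^sub>s 0 t)
      = - integral {a..b} (\<lambda>t. lam t * (\<phi> t * (axis 3 1 \<bullet> e)))"
    using DERIV_unique[OF first_variation] by simp
  have "((\<lambda>t. (J *v w' t) \<bullet> e * \<phi> t + (J *v w t) \<bullet> e * \<phi>' t) has_integral
      (J *v w b) \<bullet> e * \<phi> b - (J *v w a) \<bullet> e * \<phi> a) {a..b}"
  proof (rule fundamental_theorem_of_calculus)
    fix t assume "t \<in> {a..b}"
    then have t: "t \<in> T"
      by (rule sub)
    have "((\<lambda>t. J *v w t) has_vector_derivative J *v w' t) (at t)"
      using matvec.has_vector_derivative[OF has_vector_derivative_const w_derivative[OF t]] by simp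
    from bounded_bilinear.has_vector_derivative[OF bounded_bilinear_inner this has_vector_derivative_const]
    have "((\<lambda>t. (J *v w t) \<bullet> e) has_vector_derivative (J *v w' t) \<bullet> e) (at t)"
      by simp
    from bounded_bilinear.has_vector_derivative[OF bounded_bilinear_mult this \<phi>_derivative[OF t]]
    show "((\<lambda>t. (J *v w t) \<bullet> e * \<phi> t) has_vector_derivative
        (J *v w' t) \<bullet> e * \<phi> t + (J *v w t) \<bullet> e * \<phi>' t) (at t within {a..b})"
      by (auto intro: has_vector_derivative_at_within simp: add.commute)
  qed (use ab in simp)
  then have 2: "integral {a..b} (\<lambda>t. (J *v w' t) \<bullet> e * \<phi> t + (J *v w t) \<bullet> e * \<phi>' t) = 0"
    using \<phi> by (simp add: integral_unique)
  have "\<phi> t * ((cross3 (J *v w t) (w t) + lam t *\<^sub>R axis 3 1 - J *v w' t) \<bullet> e)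
      = (J *v w t) \<bullet> \<Omega>\<^sub>s 0 t + lam t * (\<phi> t * (axis 3 1 \<bullet> e))
        - ((J *v w' t) \<bullet> e * \<phi> t + (J *v w t) \<bullet> e * \<phi>' t)" for t
  proof -
    \<comment> \<open>Cyclic invariance of the triple product produces the gyroscopic term.\<close>
    have "cross3 (J *v w t) (w t) \<bullet> e = - ((J *v w t) \<bullet> cross3 e (w t))"
      by (simp add: cross3_simps)
    then show ?thesis
      by (simp add: \<Omega>\<^sub>s_def inner_add_left inner_diff_left inner_add_right algebra_simps)
  qed
  moreover have "(\<lambda>t. (J *v w t) \<bullet> \<Omega>\<^sub>s 0 t) integrable_on {a..b}"
      "(\<lambda>t. lam t * (\<phi> t * (axis 3 1 \<bullet> e))) integrable_on {a..b}"
      "(\<lambda>t. (J *v w' t) \<bullet> e * \<phi> t + (J *v w t) \<bullet> e * \<phi>' t) integrable_on {a..b}"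
    unfolding \<Omega>\<^sub>s_def using cont
    by (auto intro!: integrable_continuous_real continuous_intros matvec.continuous_on cross.continuous_on)
  ultimately show ?thesis
    using 1 2 by (simp add: integral_add integral_diff integrable_add)
qed

end

lemma suslov_solution: "suslov_solution J T w lam"
proof -
  have "J *v w' t = cross3 (J *v w t) (w t) + lam t *\<^sub>R axis 3 1" if t: "t \<in> T" for t
  proof -
    have "(cross3 (J *v w t) (w t) + lam t *\<^sub>R axis 3 1 - J *v w' t) \<bullet> axis i 1 = 0" for i
    proof (rule fundamental_lemma_variations[OF open_T _ _ t])
      show "continuous_on T (\<lambda>t. (cross3 (J *v w t) (w t) + lam t *\<^sub>R axis 3 1 - J *v w' t) \<bullet> axis i 1)"
        using continuous_w continuous_w' continuous_lam
        by (auto intro!: continuous_intros matvec.continuous_on cross.continuous_on)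
      show "integral {a..b} (\<lambda>t. (t - a) * (b - t) *
          ((cross3 (J *v w t) (w t) + lam t *\<^sub>R axis 3 1 - J *v w' t) \<bullet> axis i 1)) = 0"
        if "a < b" "{a..b} \<subseteq> T" for a b
      proof (rule tested_equation[OF _ _ _ that])
        \<comment> \<open>The parabola of the fundamental lemma is an admissible \<phi>: it is
          polynomial and vanishes at both ends.\<close>
        have "Ck_on (Suc (Suc 0)) (\<lambda>t. (t + - a) * (b + - t)) T"
          by (intro Ck_on_bilinear[OF bounded_bilinear_mult] Ck_on_add Ck_on_const open_T
              Ck_on_bounded_linear bounded_linear_ident bounded_linear_minus)
        then show "Ck_on (Suc (Suc 0)) (\<lambda>t. (t - a) * (b - t)) T"
          by (simp del: Ck_on.simps)
      qed auto
    qed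
    then have "(cross3 (J *v w t) (w t) + lam t *\<^sub>R axis 3 1 - J *v w' t) $ i = 0" for i
      by (simp add: inner_axis del: vector_minus_component vector_add_component)
    then show ?thesis
      by (simp add: vec_eq_iff)
  qed
  then show ?thesis
    unfolding suslov_solution_def using reconstruction(2) w_derivative by blast
qed

end


section \<open>Order of the reduced scheme\<close>

lemma inertia_tensor_det_pos:
  assumes "inertia_tensor J"
  shows "det (upper_left_block J) > 0"
proof -
  have pos: "0 < x \<bullet> (J *v x)" if "x \<noteq> 0" for x
    using assms that by (simp add: inertia_tensor_def)
  have "transpose J $ 2 $ 1 = J$2$1"
    using assms by (simp add: inertia_tensor_def)
  then have sym: "J$1$2 = J$2$1"
    by (simp add: transpose_def)
  have J11: "J$1$1 > 0"
    using pos[of "axis 1 1"]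
    by (simp add: matrix_vector_mult_def inner_vec_def sum_3 axis_def vec_eq_iff forall_3)
  \<comment> \<open>This vector makes the first component of \<open>J *v x\<close> zero and the
    second the 2x2 determinant, so the quadratic form is \<open>J$1$1\<close> times the
    determinant.\<close>
  define x :: "real^3" where "x = vector [- J$1$2, J$1$1, 0]"
  have "x \<noteq> 0"
    using J11 by (auto simp: x_def vec_eq_iff forall_3)
  then have "0 < x \<bullet> (J *v x)"
    by (rule pos)
  also have "x \<bullet> (J *v x) = J$1$1 * (J$1$1 * J$2$2 - J$1$2 * J$2$1)"
    by (simp add: x_def matrix_vector_mult_def inner_vec_def sum_3 sym algebra_simps)
  finally show ?thesis
    using J11 by (simp add: det_2 upper_left_block_def zero_less_mult_iff)
qed

section \<open>Reduction to the first two components\<close>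

definition planar :: "real^3 \<Rightarrow> real^2" where
  "planar x = vector [x$1, x$2]"

lemma bounded_linear_planar: "bounded_linear planar"
  by (rule linear_conv_bounded_linear[THEN iffD1])
    (auto simp: linear_iff planar_def vec_eq_iff forall_2)

lemma norm_planar: "x $ 3 = 0 \<Longrightarrow> norm (planar x) = norm x"
  by (simp add: norm_vec_def L2_set_def sum_2 sum_3 planar_def)

text \<open>The first two components form a linear system for the accelerations, solved by Cramer's
  rule; substituting into the third yields the multiplier.\<close>

lemma suslov_solution_planar:
  assumes J: "inertia_tensor J" and sol: "suslov_solution J T w lam" and T: "open T" "t \<in> T"
  shows "((\<lambda>t. planar (w t)) has_vector_derivative suslov_field J (planar (w t))) (at t)"
    and "lam t = suslov_multiplier J (w t)"
proof -
  define d where "d = det (upper_left_block J)"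
  have d: "d \<noteq> 0" "d = J$1$1 * J$2$2 - J$1$2 * J$2$1"
    using inertia_tensor_det_pos[OF J] by (simp_all add: d_def det_2 upper_left_block_def)
  have w3: "w s $ 3 = 0" if "s \<in> T" for s
    using sol that by (simp add: suslov_solution_def)
  obtain w' where w': "(w has_vector_derivative w') (at t)"
    and eq: "J *v w' = cross3 (J *v w t) (w t) + lam t *\<^sub>R axis 3 1"
    using sol T by (auto simp: suslov_solution_def)
  have "((\<lambda>s. w s $ 3) has_vector_derivative w' $ 3) (at t)"
    using bounded_linear.has_vector_derivative[OF bounded_linear_vec_nth w'] .
  \<comment> \<open>The constraint holds on a whole neighbourhood of \<open>t\<close>, so the third
    acceleration vanishes too.\<close>
  moreover have "((\<lambda>s. w s $ 3) has_vector_derivative 0) (at t)"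
    by (rule has_vector_derivative_transform_within_open[OF has_vector_derivative_const T])
      (simp add: w3)
  ultimately have w'3: "w' $ 3 = 0"
    by (rule vector_derivative_unique_at)
  \<comment> \<open>\<open>h\<close> is the third component of \<open>J *v w t\<close>, the common
    factor in the first two equations.\<close>
  define h where "h = J$3$1 * w t $ 1 + J$3$2 * w t $ 2"
  have eqs: "J$1$1 * w'$1 + J$1$2 * w'$2 = - (h * w t $ 2)"
    "J$2$1 * w'$1 + J$2$2 * w'$2 = h * w t $ 1"
    "J$3$1 * w'$1 + J$3$2 * w'$2 = (J$1$1 * w t $ 1 + J$1$2 * w t $ 2) * w t $ 2
       - (J$2$1 * w t $ 1 + J$2$2 * w t $ 2) * w t $ 1 + lam t"
    using arg_cong[OF eq, of "\<lambda>x. x $ 1"] arg_cong[OF eq, of "\<lambda>x. x $ 2"]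
      arg_cong[OF eq, of "\<lambda>x. x $ 3"] w3[OF T(2)] w'3
    by (simp_all add: matrix_vector_mult_def sum_3 cross3_def axis_def h_def)
  have "d * w'$1 = J$2$2 * (J$1$1 * w'$1 + J$1$2 * w'$2) - J$1$2 * (J$2$1 * w'$1 + J$2$2 * w'$2)"
    by (simp add: d(2) algebra_simps)
  also have "\<dots> = - (J$2$2 * w t $ 2 + J$1$2 * w t $ 1) * h"
    unfolding eqs by (simp add: algebra_simps)
  finally have "w'$1 = - (J$2$2 * w t $ 2 + J$1$2 * w t $ 1) * h / d"
    using d(1) by (metis nonzero_mult_div_cancel_left)
  then have 1: "w'$1 = - (1/d) * (J$2$2 * w t $ 2 + J$1$2 * w t $ 1) * h"
    by (simp add: algebra_simps divide_inverse)
  have "d * w'$2 = J$1$1 * (J$2$1 * w'$1 + J$2$2 * w'$2) - J$2$1 * (J$1$1 * w'$1 + J$1$2 * w'$2)"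
    by (simp add: d(2) algebra_simps)
  also have "\<dots> = (J$2$1 * w t $ 2 + J$1$1 * w t $ 1) * h"
    unfolding eqs by (simp add: algebra_simps)
  finally have "w'$2 = (J$2$1 * w t $ 2 + J$1$1 * w t $ 1) * h / d"
    using d(1) by (metis nonzero_mult_div_cancel_left)
  then have 2: "w'$2 = (1/d) * (J$2$1 * w t $ 2 + J$1$1 * w t $ 1) * h"
    by (simp add: algebra_simps divide_inverse)
  have "planar w' = suslov_field J (planar (w t))"
    by (simp add: planar_def suslov_field_def 1 2 h_def d_def)
  then show "((\<lambda>t. planar (w t)) has_vector_derivative suslov_field J (planar (w t))) (at t)"
    using bounded_linear.has_vector_derivative[OF bounded_linear_planar w'] by simp
  show "lam t = suslov_multiplier J (w t)"
    using eqs(3) unfolding 1 2 h_def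
    by (simp add: suslov_multiplier_def d_def[symmetric] algebra_simps divide_inverse)
qed

text \<open>A bilinear form with \<open>suslov_multiplier\<close> on its diagonal, so that
  differences of multipliers can be telescoped.\<close>

definition multiplier_form :: "real^3^3 \<Rightarrow> real^3 \<Rightarrow> real^3 \<Rightarrow> real" where
  "multiplier_form J x y =
     x$1 * (J$2$1 * y$1 + J$2$2 * y$2) - x$2 * (J$1$1 * y$1 + J$1$2 * y$2)
     + (J$3$1 * x$1 + J$3$2 * x$2) / det (upper_left_block J)
       * ((J$3$2 * J$2$1 - J$3$1 * J$2$2) * y$2 + (J$3$2 * J$1$1 - J$3$1 * J$1$2) * y$1)"

lemma bounded_bilinear_multiplier_form: "bounded_bilinear (multiplier_form J)"
  unfolding bilinear_conv_bounded_bilinear[symmetric] bilinear_def linear_iff multiplier_form_def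
  by (simp add: algebra_simps divide_inverse)

lemma suslov_multiplier_eq: "suslov_multiplier J x = multiplier_form J x x"
  by (simp add: suslov_multiplier_def multiplier_form_def)

text \<open>Telescoping h(x,x) - h(y,y) = h(x,x-y) + h(x-y,y) leaves one small factor; convergence
  bounds the other.\<close>

lemma bilinear_diag_diff_bigo:
  assumes h: "bounded_bilinear h" and x: "(x \<longlongrightarrow> l) F" and y: "(y \<longlongrightarrow> l') F"
    and xy: "(\<lambda>\<epsilon>. norm (x \<epsilon> - y \<epsilon>)) \<in> O[F](g)"
  shows "(\<lambda>\<epsilon>. norm (h (x \<epsilon>) (x \<epsilon>) - h (y \<epsilon>) (y \<epsilon>))) \<in> O[F](g :: real \<Rightarrow> real)"
proof -
  obtain K where K: "K > 0" "\<And>a b. norm (h a b) \<le> norm a * norm b * K"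
    using bounded_bilinear.pos_bounded[OF h] by blast
  \<comment> \<open>Each family eventually has norm below that of its limit plus 1; the two bounds
    add up.\<close>
  define C where "C = (norm l + norm l' + 2) * K"
  have "eventually (\<lambda>\<epsilon>. norm (x \<epsilon>) < norm l + 1) F" "eventually (\<lambda>\<epsilon>. norm (y \<epsilon>) < norm l' + 1) F"
    using tendsto_norm[OF x] tendsto_norm[OF y] by (auto intro: order_tendstoD)
  then have "eventually (\<lambda>\<epsilon>. norm (h (x \<epsilon>) (x \<epsilon>) - h (y \<epsilon>) (y \<epsilon>)) \<le> C * norm (x \<epsilon> - y \<epsilon>)) F"
  proof eventually_elim
    case (elim \<epsilon>)
    have "h (x \<epsilon>) (x \<epsilon>) - h (y \<epsilon>) (y \<epsilon>) = h (x \<epsilon>) (x \<epsilon> - y \<epsilon>) + h (x \<epsilon> - y \<epsilon>) (y \<epsilon>)"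
      by (simp add: bounded_bilinear.diff_left[OF h] bounded_bilinear.diff_right[OF h])
    also have "norm \<dots> \<le> norm (x \<epsilon>) * norm (x \<epsilon> - y \<epsilon>) * K + norm (x \<epsilon> - y \<epsilon>) * norm (y \<epsilon>) * K"
      by (intro norm_triangle_mono K)
    also have "\<dots> = (norm (x \<epsilon>) + norm (y \<epsilon>)) * (K * norm (x \<epsilon> - y \<epsilon>))"
      by (simp add: algebra_simps)
    also have "\<dots> \<le> (norm l + norm l' + 2) * (K * norm (x \<epsilon> - y \<epsilon>))"
      using elim K(1) by (intro mult_right_mono) auto
    finally show ?case
      by (simp add: C_def mult.assoc)
  qed
  then have "(\<lambda>\<epsilon>. norm (h (x \<epsilon>) (x \<epsilon>) - h (y \<epsilon>) (y \<epsilon>))) \<in> O[F](\<lambda>\<epsilon>. norm (x \<epsilon> - y \<epsilon>))"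
    by (intro bigoI[where c = C]) simp
  then show ?thesis
    using xy by (rule landau_o.big.trans)
qed

lemma tendsto_shift_at_right:
  fixes f :: "real \<Rightarrow> 'b::topological_space"
  assumes "isCont f t"
  shows "((\<lambda>\<epsilon>. f (t + \<epsilon>)) \<longlongrightarrow> f t) (at_right 0)"
proof (rule isCont_tendsto_compose[OF assms])
  show "((\<lambda>\<epsilon>. t + \<epsilon>) \<longlongrightarrow> t) (at_right 0)"
    by (auto intro!: tendsto_eq_intros)
qed

lemma eventually_shift_at_right:
  fixes T :: "real set"
  assumes "open T" "t \<in> T"
  shows "eventually (\<lambda>\<epsilon>. t + \<epsilon> \<in> T) (at_right 0)"
  using topological_tendstoD[OF tendsto_shift_at_right[where f = "\<lambda>x. x" and t = t] assms] by simp

text \<open>On the plane where the third component vanishes, \<open>planar\<close> is an isometry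
  and branches of the two schemes correspond, so orders carry over.\<close>

lemma suslov_order_suslov_scheme:
  assumes J: "inertia_tensor J" and order: "ode_order (suslov_field J) (planar_scheme J l1 l2) p"
  shows "suslov_order J (suslov_scheme J l1 l2) p p"
  unfolding suslov_order_def
proof (intro allI impI, elim conjE)
  fix a b tk w lam
  assume tk: "tk \<in> {a<..<b}" and sol: "suslov_solution J {a<..<b} w lam"
  note planar = suslov_solution_planar[OF J sol open_greaterThanLessThan]
  have w3: "w t $ 3 = 0" if "t \<in> {a<..<b}" for t
    using sol that by (simp add: suslov_solution_def)
  have ev: "eventually (\<lambda>\<epsilon>. tk + \<epsilon> \<in> {a<..<b}) (at_right 0)"
    by (rule eventually_shift_at_right[OF open_greaterThanLessThan tk])
  have lim: "((\<lambda>\<epsilon>. w (tk + \<epsilon>)) \<longlongrightarrow> w tk) (at_right 0)"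
    using sol tk by (intro tendsto_shift_at_right)
      (auto simp: suslov_solution_def intro: has_vector_derivative_continuous)
  let ?step = "suslov_scheme J l1 l2"
  have ode: "\<exists>u1. step_branch (planar_scheme J l1 l2) (planar (w tk)) u1"
    "\<And>u1. step_branch (planar_scheme J l1 l2) (planar (w tk)) u1 \<Longrightarrow>
       (\<lambda>\<epsilon>. norm (planar (w (tk + \<epsilon>)) - u1 \<epsilon>)) \<in> O[at_right 0](\<lambda>\<epsilon>. \<epsilon> ^ (p + 1))"
    using order[unfolded ode_order_def, rule_format, of tk a b "\<lambda>t. planar (w t)"] tk planar(1)
    by blast+
  show "(\<exists>w1 lam1. step_branch (\<lambda>\<epsilon> x y. ?step \<epsilon> x y (lam1 \<epsilon>)) (w tk) w1) \<and>
    (\<forall>w1 lam1. step_branch (\<lambda>\<epsilon> x y. ?step \<epsilon> x y (lam1 \<epsilon>)) (w tk) w1 \<longrightarrow>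
       (\<lambda>\<epsilon>. norm (w (tk + \<epsilon>) - w1 \<epsilon>)) \<in> O[at_right 0](\<lambda>\<epsilon>. \<epsilon> ^ (p + 1)) \<and>
       (\<lambda>\<epsilon>. \<bar>lam (tk + \<epsilon>) - lam1 \<epsilon>\<bar>) \<in> O[at_right 0](\<lambda>\<epsilon>. \<epsilon> ^ (p + 1)))"
  proof (intro conjI allI impI)
    obtain u1 where u1: "step_branch (planar_scheme J l1 l2) (planar (w tk)) u1"
      using ode(1) by blast
    \<comment> \<open>Existence: a planar branch is lifted by a zero third component.\<close>
    define w1 :: "real \<Rightarrow> real^3" where "w1 \<epsilon> = vector [u1 \<epsilon> $ 1, u1 \<epsilon> $ 2, 0]" for \<epsilon>
    have "planar (w1 \<epsilon>) = u1 \<epsilon>" "w1 \<epsilon> $ 3 = 0" for \<epsilon>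
      by (simp_all add: w1_def planar_def vec_eq_iff forall_2)
    then have "eventually (\<lambda>\<epsilon>. ?step \<epsilon> (w tk) (w1 \<epsilon>) (suslov_multiplier J (w1 \<epsilon>))) (at_right 0)"
      using u1 w3[OF tk] unfolding step_branch_def suslov_scheme_def planar_def[symmetric] by simp
    moreover have "(w1 \<longlongrightarrow> w tk) (at_right 0)"
    proof (rule vec_tendstoI)
      fix i
      have u: "((\<lambda>\<epsilon>. u1 \<epsilon> $ j) \<longlongrightarrow> planar (w tk) $ j) (at_right 0)" for j
        using u1 by (simp add: step_branch_def tendsto_vec_nth)
      show "((\<lambda>\<epsilon>. w1 \<epsilon> $ i) \<longlongrightarrow> w tk $ i) (at_right 0)"
        using u[of 1] u[of 2] exhaust_3[of i] w3[OF tk] by (auto simp: w1_def planar_def)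
    qed
    ultimately show "\<exists>w1 lam1. step_branch (\<lambda>\<epsilon> x y. ?step \<epsilon> x y (lam1 \<epsilon>)) (w tk) w1"
      by (intro exI[of _ w1] exI[of _ "\<lambda>\<epsilon>. suslov_multiplier J (w1 \<epsilon>)"]) (simp add: step_branch_def)
  next
    fix w1 lam1
    assume branch: "step_branch (\<lambda>\<epsilon> x y. ?step \<epsilon> x y (lam1 \<epsilon>)) (w tk) w1"
    then have step: "eventually (\<lambda>\<epsilon>. ?step \<epsilon> (w tk) (w1 \<epsilon>) (lam1 \<epsilon>)) (at_right 0)"
      and w1: "(w1 \<longlongrightarrow> w tk) (at_right 0)"
      by (simp_all add: step_branch_def)
    \<comment> \<open>Error bound: conversely, each branch projects to a planar one, to which the
      assumed order applies.\<close>
    have "eventually (\<lambda>\<epsilon>. planar_scheme J l1 l2 \<epsilon> (planar (w tk)) (planar (w1 \<epsilon>))) (at_right 0)"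
      using step by eventually_elim (simp add: suslov_scheme_def planar_def)
    then have "step_branch (planar_scheme J l1 l2) (planar (w tk)) (\<lambda>\<epsilon>. planar (w1 \<epsilon>))"
      unfolding step_branch_def
      using bounded_linear.tendsto[OF bounded_linear_planar w1] by blast
    then have u: "(\<lambda>\<epsilon>. norm (planar (w (tk + \<epsilon>)) - planar (w1 \<epsilon>))) \<in> O[at_right 0](\<lambda>\<epsilon>. \<epsilon> ^ (p + 1))"
      by (rule ode(2))
    have "eventually (\<lambda>\<epsilon>. norm (planar (w (tk + \<epsilon>)) - planar (w1 \<epsilon>)) = norm (w (tk + \<epsilon>) - w1 \<epsilon>))
        (at_right 0)"
      using step ev
    proof eventually_elim
      case (elim \<epsilon>)
      then show ?case
        using norm_planar[of "w (tk + \<epsilon>) - w1 \<epsilon>"] w3[of "tk + \<epsilon>"]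
        by (simp add: suslov_scheme_def linear_diff[OF bounded_linear.linear[OF bounded_linear_planar]])
    qed
    from landau_o.big.in_cong[OF this] show w: "(\<lambda>\<epsilon>. norm (w (tk + \<epsilon>) - w1 \<epsilon>)) \<in> O[at_right 0](\<lambda>\<epsilon>. \<epsilon> ^ (p + 1))"
      using u by blast
    have "eventually (\<lambda>\<epsilon>. norm (suslov_multiplier J (w (tk + \<epsilon>)) - suslov_multiplier J (w1 \<epsilon>))
        = \<bar>lam (tk + \<epsilon>) - lam1 \<epsilon>\<bar>) (at_right 0)"
      using step ev by eventually_elim (simp add: suslov_scheme_def planar(2))
    from landau_o.big.in_cong[OF this]
    show "(\<lambda>\<epsilon>. \<bar>lam (tk + \<epsilon>) - lam1 \<epsilon>\<bar>) \<in> O[at_right 0](\<lambda>\<epsilon>. \<epsilon> ^ (p + 1))"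
      using bilinear_diag_diff_bigo[OF bounded_bilinear_multiplier_form lim w1 w]
      unfolding suslov_multiplier_eq by blast
  qed
qed


section \<open>Order of the reconstruction\<close>

lemma tendsto_norm_scaleR_bigo:
  fixes f :: "'a \<Rightarrow> 'b::real_normed_vector" and c :: "'a \<Rightarrow> real"
  assumes "(f \<longlongrightarrow> l) F"
  shows "(\<lambda>\<epsilon>. norm (c \<epsilon> *\<^sub>R f \<epsilon>)) \<in> O[F](c)"
proof (rule bigoI[where c = "norm l + 1"])
  have "eventually (\<lambda>\<epsilon>. norm (f \<epsilon>) < norm l + 1) F"
    using tendsto_norm[OF assms] by (auto intro: order_tendstoD)
  then show "eventually (\<lambda>\<epsilon>. norm (norm (c \<epsilon> *\<^sub>R f \<epsilon>)) \<le> (norm l + 1) * norm (c \<epsilon>)) F"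
    by eventually_elim (simp add: mult.commute mult_left_mono)
qed

lemma tendsto_cay: "((\<lambda>\<epsilon>. cay (\<epsilon> *\<^sub>R hat x)) \<longlongrightarrow> mat 1) (at_right 0)"
proof -
  have "((\<lambda>\<epsilon>. mat 1 + (4 / (4 + \<epsilon>\<^sup>2 * (x \<bullet> x))) *\<^sub>R
     (\<epsilon> *\<^sub>R hat x + (\<epsilon>\<^sup>2 / 2) *\<^sub>R (hat x ** hat x))) \<longlongrightarrow>
     mat 1 + (4 / (4 + 0\<^sup>2 * (x \<bullet> x))) *\<^sub>R (0 *\<^sub>R hat x + (0\<^sup>2 / 2) *\<^sub>R (hat x ** hat x))) (at_right 0)"
    by (intro tendsto_intros) auto
  then show ?thesis
    by (simp add: cay_hat_scaleR)
qed

lemma cay_remainder_bigo: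
  "(\<lambda>\<epsilon>. norm (cay (\<epsilon> *\<^sub>R hat x) - mat 1 - \<epsilon> *\<^sub>R hat x)) \<in> O[at_right 0](\<lambda>\<epsilon>. \<epsilon> ^ 2)"
proof -
  define q where "q = x \<bullet> x"
  \<comment> \<open>The remainder divided exactly by \<epsilon>^2, using 4/m = 1 - \<epsilon>^2 q/m
    for m = 4 + \<epsilon>^2 q; it stays bounded as \<epsilon> tends to 0.\<close>
  define G where "G \<epsilon> = (2 / (4 + \<epsilon>\<^sup>2 * q)) *\<^sub>R (hat x ** hat x) - (\<epsilon> * q / (4 + \<epsilon>\<^sup>2 * q)) *\<^sub>R hat x" for \<epsilon>
  have "(G \<longlongrightarrow> (2 / (4 + 0\<^sup>2 * q)) *\<^sub>R (hat x ** hat x) - (0 * q / (4 + 0\<^sup>2 * q)) *\<^sub>R hat x) (at_right 0)"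
    unfolding G_def by (intro tendsto_intros) auto
  then have "(\<lambda>\<epsilon>. norm (\<epsilon>\<^sup>2 *\<^sub>R G \<epsilon>)) \<in> O[at_right 0](\<lambda>\<epsilon>. \<epsilon> ^ 2)"
    by (rule tendsto_norm_scaleR_bigo)
  moreover have "cay (\<epsilon> *\<^sub>R hat x) - mat 1 - \<epsilon> *\<^sub>R hat x = \<epsilon>\<^sup>2 *\<^sub>R G \<epsilon>" for \<epsilon>
  proof -
    define m where "m = 4 + \<epsilon>\<^sup>2 * q"
    have "m > 0"
      by (simp add: m_def q_def add_pos_nonneg)
    then have c: "4 / m = 1 - \<epsilon>\<^sup>2 * q / m"
      by (simp add: field_simps) (simp add: m_def)
    have "cay (\<epsilon> *\<^sub>R hat x) = mat 1 + (4 / m) *\<^sub>R (\<epsilon> *\<^sub>R hat x) + (2 * \<epsilon>\<^sup>2 / m) *\<^sub>R (hat x ** hat x)"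
      unfolding cay_hat_scaleR q_def[symmetric] m_def[symmetric] by (simp add: scaleR_add_right)
    then show ?thesis
      unfolding G_def m_def[symmetric]
      by (simp add: c) (simp add: vec_eq_iff algebra_simps power2_eq_square)
  qed
  ultimately show ?thesis
    by simp
qed

text \<open>For orthogonal B, I - A B^T = -(A - B) B^T, and B^T stays bounded by
  convergence.\<close>

lemma rot_dist_bigo:
  assumes B: "(B \<longlongrightarrow> B0) F" "eventually (\<lambda>\<epsilon>. orthogonal_matrix (B \<epsilon>)) F"
    and AB: "(\<lambda>\<epsilon>. norm (A \<epsilon> - B \<epsilon>)) \<in> O[F](g)"
  shows "(\<lambda>\<epsilon>. rot_dist (A \<epsilon>) (B \<epsilon>)) \<in> O[F](g :: 'a \<Rightarrow> real)"
proof -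
  obtain K where K: "K > 0" "\<And>(X :: real^3^3) (Y :: real^3^3). norm (X ** Y) \<le> norm X * norm Y * K"
    using matmul.pos_bounded by blast
  have "((\<lambda>\<epsilon>. transpose (B \<epsilon>)) \<longlongrightarrow> transpose B0) F"
    by (rule bounded_linear.tendsto[OF bounded_linear_transpose B(1)])
  then have "eventually (\<lambda>\<epsilon>. norm (transpose (B \<epsilon>)) < norm (transpose B0) + 1) F"
    by (auto intro: order_tendstoD dest: tendsto_norm)
  with B(2) have "eventually (\<lambda>\<epsilon>. norm (rot_dist (A \<epsilon>) (B \<epsilon>))
      \<le> (K * (norm (transpose B0) + 1)) * norm (norm (A \<epsilon> - B \<epsilon>))) F"
  proof eventually_elim
    case (elim \<epsilon>)
    have "mat 1 - A \<epsilon> ** transpose (B \<epsilon>) = - ((A \<epsilon> - B \<epsilon>) ** transpose (B \<epsilon>))"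
      using elim(1) by (simp add: matmul.diff_left orthogonal_matrix_def)
    then have "rot_dist (A \<epsilon>) (B \<epsilon>) \<le> norm (A \<epsilon> - B \<epsilon>) * norm (transpose (B \<epsilon>)) * K"
      unfolding rot_dist_def using K(2) by simp
    also have "\<dots> \<le> norm (A \<epsilon> - B \<epsilon>) * (norm (transpose B0) + 1) * K"
      using elim(2) K(1) by (intro mult_right_mono mult_left_mono) auto
    finally show ?case
      by (simp add: rot_dist_def ac_simps)
  qed
  from bigoI[OF this] AB show ?thesis
    by (rule landau_o.big.trans)
qed

lemma unreduced_order_cayley_reconstruction:
  assumes sym: "transpose J = J" and order: "suslov_order J step p s"
  shows "unreduced_order J (cayley_reconstruction step) (min 1 p) s"
  unfolding unreduced_order_def
\<comment> \<open>The rotation error has r = 1, since the Cayley step freezes the velocity at its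
  initial value; the velocity error has q = p, inherited from the reduced scheme.\<close>
proof (rule exI[of _ 1], rule exI[of _ p], intro conjI refl allI impI)
  fix a b tk R lam
  assume "tk \<in> {a<..<b} \<and> unreduced_solution J {a<..<b} R lam"
  then have tk: "tk \<in> {a<..<b}" and sol: "unreduced_solution J {a<..<b} R lam"
    by blast+
  interpret unreduced_trajectory J "{a<..<b}" R lam
    using sym sol by unfold_locales auto
  let ?R' = "vector_derivative R (at tk)"
  define C where "C \<epsilon> = R tk ** cay (\<epsilon> *\<^sub>R hat (w tk))" for \<epsilon>
  have R': "?R' = R tk ** hat (w tk)"
    by (rule reconstruction(1)[OF tk])
  have orth: "orthogonal_matrix (C \<epsilon>)" for \<epsilon>
    using orthogonal_cay_hat[of "\<epsilon> *\<^sub>R w tk"] orthogonal[OF tk]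
    by (simp add: C_def hat_scaleR orthogonal_matrix_mul)
  have C: "(C \<longlongrightarrow> R tk) (at_right 0)"
    using matmul.tendsto[OF tendsto_const tendsto_cay, of "R tk" "w tk"] by (simp add: C_def[abs_def])
  have RC: "(\<lambda>\<epsilon>. norm (R (tk + \<epsilon>) - C \<epsilon>)) \<in> O[at_right 0](\<lambda>\<epsilon>. \<epsilon> ^ 2)"
  proof -
    let ?r = "\<lambda>\<epsilon>. R (tk + \<epsilon>) - R tk - \<epsilon> *\<^sub>R ?R'"
      and ?c = "\<lambda>\<epsilon>. cay (\<epsilon> *\<^sub>R hat (w tk)) - mat 1 - \<epsilon> *\<^sub>R hat (w tk)"
    obtain K where K: "K > 0" "\<And>(X :: real^3^3) (Y :: real^3^3). norm (X ** Y) \<le> norm X * norm Y * K"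
      using matmul.pos_bounded by blast
    have "(\<lambda>\<epsilon>. norm (?r \<epsilon>)) \<in> O[at_right 0](\<lambda>\<epsilon>. \<epsilon> ^ 2)"
      by (rule first_order_remainder_bigo[OF open_T tk])
        (rule Ck_on_real_has_vector_derivative[OF C2 open_T], assumption,
         rule Ck_on_real_has_vector_derivative[OF Ck_on_vector_derivative[OF C2 open_T] open_T tk])
    moreover have "(\<lambda>\<epsilon>. (norm (R tk) * K) * norm (?c \<epsilon>)) \<in> O[at_right 0](\<lambda>\<epsilon>. \<epsilon> ^ 2)"
      unfolding cmult_in_bigo_iff using cay_remainder_bigo by (rule disjI2)
    ultimately have sum: "(\<lambda>\<epsilon>. norm (?r \<epsilon>) + (norm (R tk) * K) * norm (?c \<epsilon>)) \<in> O[at_right 0](\<lambda>\<epsilon>. \<epsilon> ^ 2)"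
      by (rule sum_in_bigo)
    have le: "norm (R (tk + \<epsilon>) - C \<epsilon>) \<le> norm (?r \<epsilon>) + (norm (R tk) * K) * norm (?c \<epsilon>)" for \<epsilon>
    proof -
      \<comment> \<open>Both rotations are compared with
        \<open>R tk + \<epsilon> *\<^sub>R ?R'\<close>, the common first-order expansion.\<close>
      have "R (tk + \<epsilon>) - C \<epsilon> = ?r \<epsilon> - R tk ** ?c \<epsilon>"
        by (simp add: C_def R' matmul.diff_right matmul.scaleR_right)
      also have "norm \<dots> \<le> norm (?r \<epsilon>) + norm (R tk ** ?c \<epsilon>)"
        by (rule norm_triangle_ineq4)
      finally show ?thesis
        using K(2)[of "R tk" "?c \<epsilon>"] by (simp add: mult_ac)
    qed
    have "(\<lambda>\<epsilon>. norm (R (tk + \<epsilon>) - C \<epsilon>)) \<in>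
        O[at_right 0](\<lambda>\<epsilon>. norm (?r \<epsilon>) + (norm (R tk) * K) * norm (?c \<epsilon>))"
      using le by (intro bigoI[where c = 1] always_eventually) (auto intro: order_trans[OF _ abs_ge_self])
    then show ?thesis
      using sum by (rule landau_o.big.trans)
  qed
  have suslov: "\<exists>w1 lam1. step_branch (\<lambda>\<epsilon> x y. step \<epsilon> x y (lam1 \<epsilon>)) (w tk) w1"
    "\<And>w1 lam1. step_branch (\<lambda>\<epsilon> x y. step \<epsilon> x y (lam1 \<epsilon>)) (w tk) w1 \<Longrightarrow>
       (\<lambda>\<epsilon>. norm (w (tk + \<epsilon>) - w1 \<epsilon>)) \<in> O[at_right 0](\<lambda>\<epsilon>. \<epsilon> ^ (p + 1)) \<and>
       (\<lambda>\<epsilon>. \<bar>lam (tk + \<epsilon>) - lam1 \<epsilon>\<bar>) \<in> O[at_right 0](\<lambda>\<epsilon>. \<epsilon> ^ (s + 1))"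
    using order[unfolded suslov_order_def, rule_format, of tk a b w lam] tk suslov_solution by blast+
  let ?step = "\<lambda>lam1 \<epsilon> x y. cayley_reconstruction step \<epsilon> x y (lam1 \<epsilon> :: real)"
  show "\<exists>X1 lam1. step_branch (?step lam1) (R tk, ?R') X1"
  proof -
    obtain w1 lam1 where "step_branch (\<lambda>\<epsilon> x y. step \<epsilon> x y (lam1 \<epsilon>)) (w tk) w1"
      using suslov(1) by blast
    then have w1: "eventually (\<lambda>\<epsilon>. step \<epsilon> (w tk) (w1 \<epsilon>) (lam1 \<epsilon>)) (at_right 0)"
      "(w1 \<longlongrightarrow> w tk) (at_right 0)"
      by (simp_all add: step_branch_def)
    have "((\<lambda>\<epsilon>. C \<epsilon> ** hat (w1 \<epsilon>)) \<longlongrightarrow> ?R') (at_right 0)"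
      unfolding R' by (intro matmul.tendsto C bounded_linear.tendsto[OF bounded_linear_hat] w1)
    then have "((\<lambda>\<epsilon>. (C \<epsilon>, C \<epsilon> ** hat (w1 \<epsilon>))) \<longlongrightarrow> (R tk, ?R')) (at_right 0)"
      by (intro tendsto_Pair C)
    moreover have "eventually (\<lambda>\<epsilon>. ?step lam1 \<epsilon> (R tk, ?R') (C \<epsilon>, C \<epsilon> ** hat (w1 \<epsilon>))) (at_right 0)"
      using w1(1)
      by eventually_elim (auto simp: cayley_reconstruction_def R' C_def)
    ultimately show ?thesis
      unfolding step_branch_def
      by (intro exI[of _ "\<lambda>\<epsilon>. (C \<epsilon>, C \<epsilon> ** hat (w1 \<epsilon>))"] exI[of _ lam1] conjI)
  qed
  fix R1 v1 lam1
  assume "step_branch (?step lam1) (R tk, ?R') (\<lambda>\<epsilon>. (R1 \<epsilon>, v1 \<epsilon>))"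
  then have ev: "eventually (\<lambda>\<epsilon>. ?step lam1 \<epsilon> (R tk, ?R') (R1 \<epsilon>, v1 \<epsilon>)) (at_right 0)"
    and lim: "((\<lambda>\<epsilon>. (R1 \<epsilon>, v1 \<epsilon>)) \<longlongrightarrow> (R tk, ?R')) (at_right 0)"
    by (simp_all add: step_branch_def)
  define w1 where "w1 \<epsilon> = body_velocity (R1 \<epsilon>) (v1 \<epsilon>)" for \<epsilon>
  \<comment> \<open>The velocities hidden in \<open>cayley_reconstruction\<close> are forced:
    inverting the orthogonal factor recovers them, so any branch has rotation \<open>C\<close> and a
    body velocity obeying the reduced step.\<close>
  have ev: "eventually (\<lambda>\<epsilon>. R1 \<epsilon> = C \<epsilon> \<and> step \<epsilon> (w tk) (w1 \<epsilon>) (lam1 \<epsilon>)) (at_right 0)"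
    using ev
  proof eventually_elim
    case (elim \<epsilon>)
    then obtain x x' where x: "?R' = R tk ** hat x" "v1 \<epsilon> = R1 \<epsilon> ** hat x'"
      "step \<epsilon> x x' (lam1 \<epsilon>)" "R1 \<epsilon> = R tk ** cay (\<epsilon> *\<^sub>R hat x)"
      by (auto simp: cayley_reconstruction_def)
    have "x = body_velocity (R tk) ?R'"
      unfolding x(1) by (rule body_velocity_hat[OF orthogonal[OF tk], symmetric])
    then have "x = w tk"
      by (simp add: w_def)
    with x(4) have "R1 \<epsilon> = C \<epsilon>"
      by (simp add: C_def)
    moreover have "w1 \<epsilon> = x'"
      using x(2) body_velocity_hat[OF orth] \<open>R1 \<epsilon> = C \<epsilon>\<close> by (simp add: w1_def)
    ultimately show ?case
      using x(3) \<open>x = w tk\<close> by simp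
  qed
  \<comment> \<open>Convergence of the state pair passes to body velocities by continuity, so
    \<open>w1\<close> is a genuine branch of the reduced scheme.\<close>
  have "(w1 \<longlongrightarrow> w tk) (at_right 0)"
    unfolding w1_def[abs_def] w_def
    using tendsto_fst[OF lim] tendsto_snd[OF lim]
    by (intro bounded_bilinear.tendsto[OF bounded_bilinear_body_velocity]) simp_all
  moreover have "eventually (\<lambda>\<epsilon>. step \<epsilon> (w tk) (w1 \<epsilon>) (lam1 \<epsilon>)) (at_right 0)"
    using ev by eventually_elim simp
  ultimately have "step_branch (\<lambda>\<epsilon> x y. step \<epsilon> x y (lam1 \<epsilon>)) (w tk) w1"
    by (simp add: step_branch_def)
  note estimates = suslov(2)[OF this]
  have "eventually (\<lambda>\<epsilon>. orthogonal_matrix (C \<epsilon>)) (at_right 0)"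
    by (simp add: orth)
  from rot_dist_bigo[OF C this RC]
  have rot: "(\<lambda>\<epsilon>. rot_dist (R (tk + \<epsilon>)) (C \<epsilon>)) \<in> O[at_right 0](\<lambda>\<epsilon>. \<epsilon> ^ (1 + 1))"
    by (simp only: one_add_one)
  have "eventually (\<lambda>\<epsilon>. rot_dist (R (tk + \<epsilon>)) (C \<epsilon>) = rot_dist (R (tk + \<epsilon>)) (R1 \<epsilon>)) (at_right 0)"
    using ev by eventually_elim simp
  from landau_o.big.in_cong[OF this] rot
  show "(\<lambda>\<epsilon>. rot_dist (R (tk + \<epsilon>)) (R1 \<epsilon>)) \<in> O[at_right 0](\<lambda>\<epsilon>. \<epsilon> ^ (1 + 1))"
    by (rule iffD1)
  have "eventually (\<lambda>\<epsilon>. norm (vee (matrix_inv (R (tk + \<epsilon>)) ** vector_derivative R (at (tk + \<epsilon>)))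
      - vee (matrix_inv (R1 \<epsilon>) ** v1 \<epsilon>)) = norm (w (tk + \<epsilon>) - w1 \<epsilon>)) (at_right 0)"
    using ev eventually_shift_at_right[OF open_T tk]
  proof eventually_elim
    case (elim \<epsilon>)
    then show ?case
      using orth[of \<epsilon>] by (simp add: body_velocity_eq orthogonal w_def w1_def)
  qed
  from landau_o.big.in_cong[OF this] show "(\<lambda>\<epsilon>. norm (vee (matrix_inv (R (tk + \<epsilon>)) ** vector_derivative R (at (tk + \<epsilon>)))
      - vee (matrix_inv (R1 \<epsilon>) ** v1 \<epsilon>))) \<in> O[at_right 0](\<lambda>\<epsilon>. \<epsilon> ^ (p + 1))"
    using estimates by (rule iffD2[OF _ conjunct1])
  show "(\<lambda>\<epsilon>. \<bar>lam (tk + \<epsilon>) - lam1 \<epsilon>\<bar>) \<in> O[at_right 0](\<lambda>\<epsilon>. \<epsilon> ^ (s + 1))"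
    using estimates by (rule conjunct2)
qed

theorem proposition5p2:
  fixes J :: "real^3^3"
    and l1 l2 :: "(real^2) \<times> (real^2) \<times> real \<Rightarrow> real"
    and p :: nat
  assumes "inertia_tensor J"
    and "p \<ge> 1"
    and "smooth_on UNIV l1" and "smooth_on UNIV l2"
    and "ode_order (suslov_field J) (planar_scheme J l1 l2) p"
  shows "suslov_order J (suslov_scheme J l1 l2) p p \<and>
         (\<exists>p' s'. p' \<ge> 1 \<and> s' \<ge> p \<and>
            unreduced_order J (cayley_reconstruction (suslov_scheme J l1 l2)) p' s')"
proof (intro conjI)
  show reduced: "suslov_order J (suslov_scheme J l1 l2) p p"
    using assms by (intro suslov_order_suslov_scheme)
  have "transpose J = J"
    using assms by (simp add: inertia_tensor_def)
  \<comment> \<open>For \<open>p \<ge> 1\<close> the first order \<open>min 1 p\<close> equals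
    1.\<close>
  from unreduced_order_cayley_reconstruction[OF this reduced] \<open>p \<ge> 1\<close>
  show "\<exists>p' s'. p' \<ge> 1 \<and> s' \<ge> p \<and>
      unreduced_order J (cayley_reconstruction (suslov_scheme J l1 l2)) p' s'"
    by (intro exI[of _ "min 1 p"] exI[of _ p]) simp
qed

end
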